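(* Let $d\ge1$, $0<s\le2$ and $1<p<\infty$, and consider $\Lambda^s$ on $\mathbb T^d=\mathbb R^d/\mathbb Z^d=[-\tfrac12,\tfrac12]^d$. There are constants $c_{p,s,d}>0$ and $\tilde c_{p,s,d}>0$ depending only on $(p,s,d)$ such that for every smooth $f:\mathbb T^d\to\mathbb R$ with $\int_{\mathbb T^d}f\,dx=0$, \[ \|e^{-t\Lambda^s}f\|_{L^p(\mathbb T^d)}\le e^{-c_{p,s,d}t}\|f\|_{L^p(\mathbb T^d)}\quad\text{for all }t>0, \] and \[ \int_{\mathbb T^d}(\Lambda^s f)\,|f|^{p-2}f\,dx\ge \tilde c_{p,s,d}\|f\|_{L^p(\mathbb T^d)}^p . \]
   Context: Fourier coefficients on $\mathbb T^d$: $\widehat f(k)=\int_{\mathbb T^d}f(x)e^{-2\pi ik\cdot x}dx$, $k\in\mathbb Z^d$, so $f(x)=\sum_{k\in\mathbb Z^d}\widehat f(k)e^{2\pi ik\cdot x}$. For $s>0$, $\Lambda^s$ is the Fourier multiplier $\widehat{\Lambda^s f}(k)=|k|^s\widehat f(k)$, and $e^{-t\Lambda^s}$ is the multiplier $e^{-t|k|^s}$. *)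

theory Defs
  imports "HOL-Analysis.Analysis"
begin

text \<open>The torus T^d = R^d / Z^d is represented by functions on real^'n (d = CARD('n))
  that are 1-periodic in every coordinate; the fundamental domain is [-1/2,1/2]^d.\<close>

definition torus_cube :: "(real^'n) set" where
  "torus_cube = cbox (vec (-1/2)) (vec (1/2))"

definition periodic_Zd :: "(real^'n \<Rightarrow> real) \<Rightarrow> bool" where
  "periodic_Zd f \<longleftrightarrow> (\<forall>x i. f (x + axis i 1) = f x)"

coinductive smooth_fun :: "(real^'n \<Rightarrow> real) \<Rightarrow> bool" where
  "(\<forall>x. g differentiable (at x)) \<Longrightarrow>
   (\<forall>i. smooth_fun (\<lambda>x. frechet_derivative g (at x) (axis i 1))) \<Longrightarrow> smooth_fun g"

definition int_lattice :: "(real^'n) set" where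
  "int_lattice = {k. \<forall>i. k $ i \<in> \<int>}"

definition fourier_coeff :: "(real^'n \<Rightarrow> real) \<Rightarrow> real^'n \<Rightarrow> complex" where
  "fourier_coeff f k = integral torus_cube (\<lambda>x. complex_of_real (f x) * cis (- 2 * pi * (k \<bullet> x)))"

text \<open>Fourier multiplier with symbol m(|k|); the result is real for real f, so we take
  the real part of the (complex) Fourier series.\<close>
definition fourier_mult :: "(real \<Rightarrow> real) \<Rightarrow> (real^'n \<Rightarrow> real) \<Rightarrow> real^'n \<Rightarrow> real" where
  "fourier_mult m f x = Re (infsum (\<lambda>k. complex_of_real (m (norm k)) * fourier_coeff f k
                                        * cis (2 * pi * (k \<bullet> x))) int_lattice)"

definition frac_lap :: "real \<Rightarrow> (real^'n \<Rightarrow> real) \<Rightarrow> real^'n \<Rightarrow> real" where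
  "frac_lap s f = fourier_mult (\<lambda>r. r powr s) f"

definition frac_semigroup :: "real \<Rightarrow> real \<Rightarrow> (real^'n \<Rightarrow> real) \<Rightarrow> real^'n \<Rightarrow> real" where
  "frac_semigroup s t f = fourier_mult (\<lambda>r. exp (- t * r powr s)) f"

definition Lp_norm_T :: "real \<Rightarrow> (real^'n \<Rightarrow> real) \<Rightarrow> real" where
  "Lp_norm_T p f = (integral torus_cube (\<lambda>x. \<bar>f x\<bar> powr p)) powr (1 / p)"

end

theory Submission
  imports Defs "HOL-Real_Asymp.Real_Asymp"
begin

text \<open>
  The operators \<open>P\<^sub>t = frac_semigroup s t\<close> preserve positivity (Gaussian multipliers are limits of averaged
  translations, and the case \<open>s < 2\<close> follows by subordination) and fix constants. Let \<open>g = spow (p / 2) f\<close>,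
  so that \<open>g\<^sup>2\<close> is the \<open>p\<close>-th power of the modulus of \<open>f\<close>. Young's inequality with remainder bounds the Bregman
  divergence of the \<open>p\<close>-th power from below by a multiple of the squared difference of the corresponding
  values of \<open>g\<close>; applying \<open>P\<^sub>t\<close> pointwise and integrating, the loss of \<open>L\<^sup>p\<close> energy between \<open>f\<close> and \<open>P\<^sub>t f\<close>
  dominates a multiple of the loss of \<open>L\<^sup>2\<close> energy between \<open>g\<close> and \<open>P\<^sub>t g\<close>, which by the spectral gap is at least
  \<open>1 - exp (- 2 * t)\<close> times the variance of \<open>g\<close>. If \<open>f\<close> has mean zero, that variance is at least half of
  the full energy. This gives exponential decay for \<open>t \<le> 1\<close>, hence for all \<open>t\<close> by the semigroup law, and
  differentiating at \<open>t = 0\<close> gives the dissipation inequality.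
\<close>

section \<open>Integration over the torus\<close>

text \<open>A comparison of dissipations at time 0 would meet the obstacle that \<open>g\<close>
  need not be smooth: for \<open>p < 2\<close> it may be only Hoelder continuous at the zeros of
  \<open>f\<close>. At a positive time the symbol \<open>exp (- t * norm k powr s)\<close> is
  summable over the lattice, so \<open>frac_semigroup s t\<close> acts on every continuous function.
  The nonlinear estimates are therefore made at positive times, and only the smooth \<open>f\<close>
  is differentiated in \<open>t\<close>. The operators are given by symbols and not by kernels.
  Positivity is stated for trigonometric polynomials, where pointwise limits of symbols are
  harmless, and carried to continuous functions by Fejer means. Positivity, linearity and invariance
  of constants then do the work of Jensen's inequality: the Bregman inequality is frozen at the
  value \<open>A\<close> of \<open>frac_semigroup s t f\<close> at \<open>x\<close>, and its tangent
  term averages to zero. The mean of \<open>g\<close> need not vanish when that of \<open>f\<close>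
  does. The variance bound comes from comparing
  \<open>(a - b) * (spow (p - 1) a - spow (p - 1) b)\<close> with the square of
  \<open>spow (p / 2) a - spow (p / 2) b\<close>.\<close>

lemma torus_cube_measure: "measure lborel (torus_cube :: (real^'n) set) = 1"
proof -
  have "torus_cube \<noteq> ({} :: (real^'n) set)"
    by (auto simp: torus_cube_def mem_box_cart interval_ne_empty_cart)
  then show ?thesis
    unfolding torus_cube_def by (subst content_cbox_cart) auto
qed

lemma integral_torus_const: "integral (torus_cube :: (real^'n) set) (\<lambda>x. c :: 'b::euclidean_space) = c"
  using torus_cube_measure[where 'n='n] unfolding torus_cube_def by simp

lemma compact_torus_cube: "compact torus_cube"
  by (simp add: torus_cube_def compact_cbox)

lemma torus_integrable:
  fixes f :: "real^'n \<Rightarrow> 'b::banach"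
  shows "continuous_on torus_cube f \<Longrightarrow> f integrable_on torus_cube"
  unfolding torus_cube_def by (rule integrable_continuous)

lemma torus_integral_norm_bound:
  fixes f :: "real^'n \<Rightarrow> 'b::euclidean_space"
  assumes "continuous_on torus_cube f" and "\<And>x. x \<in> torus_cube \<Longrightarrow> norm (f x) \<le> B"
  shows "norm (integral torus_cube f) \<le> B"
proof -
  have "norm (integral torus_cube f) \<le> integral (torus_cube :: (real^'n) set) (\<lambda>x. B)"
    using assms by (intro integral_norm_bound_integral torus_integrable) auto
  then show ?thesis by (simp add: integral_torus_const)
qed

lemma torus_integral_complex_of_real:
  fixes f :: "real^'n \<Rightarrow> real"
  assumes "continuous_on torus_cube f"
  shows "integral torus_cube (\<lambda>x. complex_of_real (f x)) = complex_of_real (integral torus_cube f)"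
  using integral_linear[OF torus_integrable[OF assms] bounded_linear_of_real[where 'a=complex]]
  by (simp add: o_def)

text \<open>Lengthen the cube by \<open>h\<close> in direction \<open>i\<close> and cut the result
  at \<open>-1/2 + h\<close> and at \<open>1/2\<close>. The bottom slab of the first cut and the top
  slab of the second are one period apart, so the two unit cubes that remain carry the same
  integral.\<close>

lemma periodic_shift_integral:
  fixes F :: "real^'n \<Rightarrow> 'b::banach"
  assumes cont: "continuous_on UNIV F" and per: "\<And>x. F (x + axis i 1) = F x"
    and h: "0 \<le> h" "h \<le> 1"
  shows "integral torus_cube (\<lambda>x. F (x + axis i h)) = integral torus_cube F"
proof -
  let ?a = "vec (-1/2) :: real^'n" and ?b = "vec (1/2) :: real^'n"
  let ?v = "axis i h :: real^'n"
  define Lo where "Lo = integral (cbox ?a (?b + axis i (h-1))) F"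
  have intg: "F integrable_on cbox u v" for u v
    using cont continuous_on_subset by (intro integrable_continuous) blast
  have hi: "(F has_integral integral (cbox u v) F) (cbox u v)" for u v
    using intg by (simp add: integrable_integral)
  have B: "axis i (1::real) \<in> Basis" by (simp add: axis_in_Basis_iff)
  have mem: "A = B \<longleftrightarrow> (\<forall>x. x \<in> A \<longleftrightarrow> x \<in> B)" for A B :: "(real^'n) set" by auto
  have mem0: "x \<in> cbox (?a + axis i u) (?b + axis i v) \<longleftrightarrow>
      (\<forall>j. j \<noteq> i \<longrightarrow> -1/2 \<le> x $ j \<and> x $ j \<le> 1/2) \<and> -1/2 + u \<le> x $ i \<and> x $ i \<le> 1/2 + v" for x u v
    unfolding mem_box_cart
    by (rule iffI, simp add: axis_def split: if_splits,
        metis (no_types, lifting) add.right_neutral divide_minus_left,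
        simp add: axis_def)
  have ax0: "axis i 0 = (0 :: real^'n)" by (simp add: vec_eq_iff axis_def)
  note mem1 = mem0[where u = 0, unfolded ax0 add_0_right]
  note mem2 = mem1[where v = 0, unfolded ax0 add_0_right]
  let ?D = "cbox ?a (?b + ?v)"
  have D1: "?D \<inter> {x. x \<bullet> axis i 1 \<le> -1/2 + h} = cbox ?a (?b + axis i (h-1))"
    using h unfolding mem Int_iff mem_Collect_eq mem0 mem1 mem2 inner_axis by auto
  have D2: "?D \<inter> {x. x \<bullet> axis i 1 \<ge> -1/2 + h} = cbox (?a + ?v) (?b + ?v)"
    using h unfolding mem Int_iff mem_Collect_eq mem0 mem1 mem2 inner_axis by auto
  have D3: "?D \<inter> {x. x \<bullet> axis i 1 \<le> 1/2} = cbox ?a ?b"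
    using h unfolding mem Int_iff mem_Collect_eq mem0 mem1 mem2 inner_axis by auto
  have D4: "?D \<inter> {x. x \<bullet> axis i 1 \<ge> 1/2} = cbox (?a + axis i 1) (?b + ?v)"
    using h unfolding mem Int_iff mem_Collect_eq mem0 mem1 mem2 inner_axis by auto
  have s1: "(F has_integral (Lo + integral (cbox (?a + ?v) (?b + ?v)) F)) ?D"
    by (rule has_integral_split[OF _ _ B, where c = "-1/2 + h"])
       (unfold D1 D2 Lo_def, rule hi, rule hi)
  have s2: "(F has_integral (integral (cbox ?a ?b) F + integral (cbox (?a + axis i 1) (?b + ?v)) F)) ?D"
    by (rule has_integral_split[OF _ _ B, where c = "1/2"])
       (unfold D3 D4, rule hi, rule hi)
  have v: "?b + axis i (h-1) + axis i 1 = ?b + ?v"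
    by (simp add: vec_eq_iff axis_def)
  have "integral (cbox (?a + axis i 1) (?b + ?v)) F = integral (cbox ?a (?b + axis i (h-1))) (F \<circ> (+) (axis i 1))"
    unfolding integral_shift_cbox_plus v ..
  also have "F \<circ> (+) (axis i 1) = F"
    using per by (auto simp: o_def add.commute)
  finally have "integral (cbox (?a + axis i 1) (?b + ?v)) F = Lo" by (simp add: Lo_def)
  with has_integral_unique[OF s1 s2]
  have "integral (cbox (?a + ?v) (?b + ?v)) F = integral (cbox ?a ?b) F" by simp
  moreover have "integral (cbox ?a ?b) (F \<circ> (+) ?v) = integral (cbox (?a + ?v) (?b + ?v)) F"
    by (rule integral_shift_cbox_plus)
  ultimately show ?thesis
    unfolding torus_cube_def by (simp add: o_def add.commute)
qed

lemma cis_lattice_periodic: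
  assumes "k \<in> int_lattice"
  shows "cis (2 * pi * (k \<bullet> (x + axis i 1))) = cis (2 * pi * (k \<bullet> x))"
proof -
  obtain n where n: "k $ i = of_int n" using assms by (auto simp: int_lattice_def Ints_def)
  have "cis (2 * pi * (k \<bullet> (x + axis i 1))) = cis (2 * pi * (k \<bullet> x)) * cis (2 * pi * of_int n)"
    unfolding cis_mult by (simp add: inner_add_right inner_axis n distrib_left)
  also have "cis (2 * pi * of_int n) = 1" by (rule cis_multiple_2pi) simp
  finally show ?thesis by simp
qed

lemma continuous_on_cis [continuous_intros]:
  "continuous_on A f \<Longrightarrow> continuous_on A (\<lambda>x. cis (f x))"
  unfolding cis_conv_exp by (intro continuous_intros)

lemma norm_lattice_ge_1:
  assumes "k \<in> int_lattice" "k \<noteq> 0"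
  shows "norm k \<ge> 1"
proof -
  obtain i where i: "k $ i \<noteq> 0" using assms(2) by (auto simp: vec_eq_iff)
  have "k $ i \<in> \<int>" using assms(1) by (auto simp: int_lattice_def)
  then have "1 \<le> \<bar>k $ i\<bar>" using i by (simp add: Ints_nonzero_abs_ge1)
  also have "\<dots> \<le> norm k" by (rule component_le_norm_cart)
  finally show ?thesis .
qed

text \<open>For \<open>k \<noteq> 0\<close> a translation by half a wavelength changes the sign of
  the character but not its integral.\<close>

lemma integral_cis_lattice:
  fixes k :: "real^'n"
  assumes "k \<in> int_lattice"
  shows "integral torus_cube (\<lambda>x. cis (2 * pi * (k \<bullet> x))) = (if k = 0 then 1 else 0)"
proof (cases "k = 0")
  case True then show ?thesis by (simp add: integral_torus_const)
next
  case False
  then obtain i where i: "k $ i \<noteq> 0" by (auto simp: vec_eq_iff)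
  have "k $ i \<in> \<int>" using assms(1) by (auto simp: int_lattice_def)
  then have ge: "1 \<le> \<bar>k $ i\<bar>" using i by (simp add: Ints_nonzero_abs_ge1)
  \<comment> \<open>Half a wavelength in direction \<open>i\<close>; it is at most 1 because a
    nonzero integer has modulus at least 1.\<close>
  define h where "h = 1 / (2 * \<bar>k $ i\<bar>)"
  have h: "0 \<le> h" "h \<le> 1" using ge by (auto simp: h_def field_simps)
  let ?I = "integral torus_cube (\<lambda>x. cis (2 * pi * (k \<bullet> x)))"
  have "integral torus_cube (\<lambda>x. cis (2 * pi * (k \<bullet> (x + axis i h)))) = ?I"
    by (rule periodic_shift_integral[OF _ _ h, where F = "\<lambda>x. cis (2 * pi * (k \<bullet> x))"])
       (auto intro!: continuous_intros cis_lattice_periodic assms)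
  also have "(\<lambda>x. cis (2 * pi * (k \<bullet> (x + axis i h)))) = (\<lambda>x. - cis (2 * pi * (k \<bullet> x)))"
  proof
    fix x
    have "cis (2 * pi * (k \<bullet> (x + axis i h))) = cis (2 * pi * (k \<bullet> x)) * cis (2 * pi * k $ i * h)"
      by (simp add: inner_add_right inner_axis cis_mult distrib_left mult.assoc)
    also have "2 * pi * k $ i * h = pi * sgn (k $ i)"
      using i by (auto simp: h_def sgn_if field_simps)
    also have "cis (pi * sgn (k $ i)) = -1"
      using i by (auto simp: sgn_if simp flip: cis_cnj)
    finally show "cis (2 * pi * (k \<bullet> (x + axis i h))) = - cis (2 * pi * (k \<bullet> x))" by simp
  qed
  finally have "- ?I = ?I" by simp
  then show ?thesis using False by simp
qed

lemma int_lattice_diff: "k \<in> int_lattice \<Longrightarrow> l \<in> int_lattice \<Longrightarrow> k - l \<in> int_lattice"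
  and int_lattice_uminus: "k \<in> int_lattice \<Longrightarrow> - k \<in> int_lattice"
  and int_lattice_0: "0 \<in> int_lattice"
  and int_lattice_axis: "axis i 1 \<in> int_lattice"
  by (auto simp: int_lattice_def axis_def)

section \<open>Sums over the lattice\<close>

text \<open>Dominated convergence for unordered sums: by the M-test the finite partial sums converge
  uniformly in \<open>n\<close>, so the two limits may be exchanged. The filter \<open>G\<close> is
  general because the lemma serves both Fejer means (\<open>N\<close> to infinity) and small times
  (\<open>t\<close> to 0 from the right).\<close>

lemma infsum_tendsto_dominated:
  fixes u :: "'a \<Rightarrow> 'b \<Rightarrow> 'c::banach"
  assumes lim: "\<And>k. k \<in> A \<Longrightarrow> (u k \<longlongrightarrow> v k) G"
    and bound: "\<forall>\<^sub>F n in G. \<forall>k\<in>A. norm (u k n) \<le> M k"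
    and M: "M summable_on A"
  shows "((\<lambda>n. \<Sum>\<^sub>\<infinity>k\<in>A. u k n) \<longlongrightarrow> (\<Sum>\<^sub>\<infinity>k\<in>A. v k)) G"
proof (cases "G = bot")
  case False
  define Y where "Y = {n. \<forall>k\<in>A. norm (u k n) \<le> M k}"
  have ul: "uniform_limit Y (\<lambda>X n. \<Sum>k\<in>X. u k n) (\<lambda>n. \<Sum>\<^sub>\<infinity>k\<in>A. u k n) (finite_subsets_at_top A)"
    by (rule Weierstrass_m_test_general[OF _ M]) (auto simp: Y_def)
  have nv: "norm (v k) \<le> M k" if "k \<in> A" for k
    by (rule tendsto_upperbound[OF tendsto_norm[OF lim[OF that]] _ False])
       (use bound that in \<open>auto elim: eventually_mono\<close>)
  have "(\<lambda>k. norm (v k)) summable_on A"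
    by (rule Infinite_Sum.abs_summable_on_comparison_test'[OF M]) (rule nv)
  then have "v summable_on A" by (rule abs_summable_summable)
  then have vs: "(sum v \<longlongrightarrow> infsum v A) (finite_subsets_at_top A)"
    by (rule infsum_tendsto)
  have fin: "\<forall>\<^sub>F X in finite_subsets_at_top A. ((\<lambda>n. \<Sum>k\<in>X. u k n) \<longlongrightarrow> sum v X) G"
    by (rule eventually_finite_subsets_at_top_weakI) (auto intro!: tendsto_sum lim)
  show ?thesis
    by (rule swap_uniform_limit'[OF fin vs ul])
       (use bound in \<open>auto simp: Y_def\<close>)
qed simp

lemma infsum_continuous_on:
  fixes f :: "'i \<Rightarrow> 'a::topological_space \<Rightarrow> 'c::banach"
  assumes cont: "\<And>i. i \<in> A \<Longrightarrow> continuous_on X (f i)"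
    and bound: "\<And>i x. i \<in> A \<Longrightarrow> x \<in> X \<Longrightarrow> norm (f i x) \<le> M i"
    and M: "M summable_on A"
  shows "continuous_on X (\<lambda>x. \<Sum>\<^sub>\<infinity>i\<in>A. f i x)"
  by (rule uniform_limit_theorem[OF _ Weierstrass_m_test_general[OF bound M]])
     (auto intro!: eventually_finite_subsets_at_top_weakI continuous_on_sum cont)

lemma torus_integral_infsum:
  fixes f :: "'i \<Rightarrow> real^'n \<Rightarrow> 'c::banach"
  assumes cont: "\<And>i. i \<in> A \<Longrightarrow> continuous_on torus_cube (f i)"
    and bound: "\<And>i x. i \<in> A \<Longrightarrow> x \<in> torus_cube \<Longrightarrow> norm (f i x) \<le> M i"
    and M: "M summable_on A"
  shows "integral torus_cube (\<lambda>x. \<Sum>\<^sub>\<infinity>i\<in>A. f i x) = (\<Sum>\<^sub>\<infinity>i\<in>A. integral torus_cube (f i))"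
proof -
  \<comment> \<open>The sums run over \<open>X \<inter> A\<close> so that every member of the family
    is continuous, also for index sets \<open>X\<close> that are not contained in
    \<open>A\<close>.\<close>
  have ul: "uniform_limit (cbox (vec (-1/2)) (vec (1/2))) (\<lambda>X x. \<Sum>i\<in>X \<inter> A. f i x)
      (\<lambda>x. \<Sum>\<^sub>\<infinity>i\<in>A. f i x) (finite_subsets_at_top A)"
    using Weierstrass_m_test_general[OF bound M]
    by (rule uniform_limit_cong[THEN iffD1, rotated -1])
       (auto simp: torus_cube_def Int_absorb2 intro!: eventually_finite_subsets_at_top_weakI)
  have c: "continuous_on (cbox (vec (-1/2)) (vec (1/2))) (\<lambda>x. \<Sum>i\<in>X \<inter> A. f i x)" for X
    by (intro continuous_on_sum cont[unfolded torus_cube_def]) auto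
  obtain I J where I: "\<And>X. ((\<lambda>x. \<Sum>i\<in>X \<inter> A. f i x) has_integral I X) torus_cube"
    and J: "((\<lambda>x. \<Sum>\<^sub>\<infinity>i\<in>A. f i x) has_integral J) torus_cube"
    and lim: "(I \<longlongrightarrow> J) (finite_subsets_at_top A)"
    using uniform_limit_integral_cbox[OF ul c] unfolding torus_cube_def by auto
  have "\<forall>\<^sub>F X in finite_subsets_at_top A. I X = (\<Sum>i\<in>X. integral torus_cube (f i))"
  proof (rule eventually_finite_subsets_at_top_weakI)
    fix X assume X: "finite X" "X \<subseteq> A"
    have "((\<lambda>x. \<Sum>i\<in>X. f i x) has_integral (\<Sum>i\<in>X. integral torus_cube (f i))) torus_cube"
      using X by (intro has_integral_sum integrable_integral torus_integrable cont) auto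
    with I[of X] X show "I X = (\<Sum>i\<in>X. integral torus_cube (f i))"
      by (auto simp: Int_absorb2 intro: has_integral_unique)
  qed
  with lim have "((\<lambda>i. integral torus_cube (f i)) has_sum J) A"
    unfolding has_sum_def by (rule Lim_transform_eventually)
  then show ?thesis using J by (simp add: infsumI integral_unique)
qed

section \<open>Summable weights on the lattice\<close>

lemma summable_on_Ints_inverse_square: "(\<lambda>x::real. 1 / (1 + \<bar>x\<bar>)\<^sup>2) summable_on \<int>"
proof -
  have Z: "\<int> = range (\<lambda>n::nat. real n) \<union> range (\<lambda>n::nat. - real n)"
    by (auto simp: Ints_def image_iff)
       (metis int_cases2 of_int_minus of_int_of_nat_eq, metis of_int_of_nat_eq, metis of_int_minus of_int_of_nat_eq)
  have s: "(\<lambda>n::nat. 1 / (1 + real n)\<^sup>2) summable_on UNIV"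
  proof (rule norm_summable_imp_summable_on)
    have "summable (\<lambda>n. inverse ((real (Suc n))\<^sup>2))"
      using inverse_power_summable[of 2, where 'a=real] by (subst summable_Suc_iff) simp
    then show "summable (\<lambda>n. norm (1 / (1 + real n)\<^sup>2))"
      by (simp add: inverse_eq_divide add.commute)
  qed
  show ?thesis unfolding Z
  proof (rule summable_on_union)
    show "(\<lambda>x::real. 1 / (1 + \<bar>x\<bar>)\<^sup>2) summable_on range (\<lambda>n::nat. real n)"
      by (subst summable_on_reindex) (use s in \<open>auto simp: o_def inj_on_def\<close>)
    show "(\<lambda>x::real. 1 / (1 + \<bar>x\<bar>)\<^sup>2) summable_on range (\<lambda>n::nat. - real n)"
      by (subst summable_on_reindex) (use s in \<open>auto simp: o_def inj_on_def\<close>)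
  qed
qed

text \<open>Each \<open>\<bar>k $ i\<bar>\<close> is at most \<open>norm k\<close>, so the radial
  weight lies below a product of one-dimensional inverse squares, one for each coordinate. Hence the
  exponent \<open>2 * CARD('n)\<close>.\<close>

lemma summable_on_lattice_power:
  "(\<lambda>k::real^'n. 1 / (1 + norm k) ^ (2 * CARD('n))) summable_on int_lattice"
proof -
  have cnt: "countable (\<int> :: real set)" unfolding Ints_def by simp
  have "Infinite_Set_Sum.abs_summable_on (\<lambda>x::real. 1 / (1 + \<bar>x\<bar>)\<^sup>2) \<int>"
    using summable_on_Ints_inverse_square unfolding abs_summable_equivalent[symmetric]
    by (simp add: power2_eq_square)
  then have "Infinite_Set_Sum.abs_summable_on (\<lambda>g. \<Prod>i\<in>(UNIV::'n set). 1 / (1 + \<bar>g i\<bar>)\<^sup>2) (PiE UNIV (\<lambda>_. \<int> :: real set))"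
    by (intro abs_summable_on_prod_PiE cnt) auto
  then have 1: "(\<lambda>g. \<Prod>i\<in>(UNIV::'n set). 1 / (1 + \<bar>g i\<bar>)\<^sup>2) summable_on (PiE UNIV (\<lambda>_. \<int> :: real set))"
    unfolding abs_summable_equivalent[symmetric] by (rule abs_summable_summable)
  have bij: "bij_betw (\<lambda>k::real^'n. ($) k) int_lattice (PiE UNIV (\<lambda>_. \<int> :: real set))"
    by (rule bij_betw_byWitness[where f' = vec_lambda]) (auto simp: int_lattice_def)
  have 2: "(\<lambda>k::real^'n. \<Prod>i\<in>(UNIV::'n set). 1 / (1 + \<bar>k $ i\<bar>)\<^sup>2) summable_on int_lattice"
    using 1 summable_on_reindex_bij_betw[OF bij, of "\<lambda>g. \<Prod>i\<in>UNIV. 1 / (1 + \<bar>g i\<bar>)\<^sup>2"] by simp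
  show ?thesis
  proof (rule summable_on_comparison_test[OF 2])
    fix k :: "real^'n"
    have "(\<Prod>i\<in>(UNIV::'n set). 1 / (1 + norm k)\<^sup>2) \<le> (\<Prod>i\<in>(UNIV::'n set). 1 / (1 + \<bar>k $ i\<bar>)\<^sup>2)"
      by (intro prod_mono conjI divide_left_mono power_mono add_left_mono component_le_norm_cart)
         (auto intro!: mult_pos_pos zero_less_power add_pos_nonneg)
    then show "1 / (1 + norm k) ^ (2 * CARD('n)) \<le> (\<Prod>i\<in>(UNIV::'n set). 1 / (1 + \<bar>k $ i\<bar>)\<^sup>2)"
      by (simp add: power_mult power_one_over)
  qed auto
qed

text \<open>The stretched exponential beats every polynomial. With this, bounded Fourier
  coefficients already give an absolutely convergent series at positive times.\<close>

lemma summable_on_lattice_exp_powr: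
  fixes s t :: real
  assumes "0 < s" "0 < t"
  shows "(\<lambda>k::real^'n. exp (- t * norm k powr s)) summable_on int_lattice"
proof -
  define N where "N = 2 * CARD('n)"
  have "((\<lambda>r. (1 + r) ^ N * exp (- t * r powr s)) \<longlongrightarrow> 0) at_top"
    using assms by real_asymp
  then have "\<forall>\<^sub>F r in at_top. (1 + r) ^ N * exp (- t * r powr s) < 1"
    by (rule order_tendstoD) simp
  then obtain R where R: "\<And>r. r \<ge> R \<Longrightarrow> (1 + r) ^ N * exp (- t * r powr s) < 1"
    by (auto simp: eventually_at_top_linorder)
  define C where "C = max 1 ((1 + \<bar>R\<bar>) ^ N)"
  have bd: "(1 + r) ^ N * exp (- t * r powr s) \<le> C" if "r \<ge> 0" for r
  proof (cases "r \<ge> R")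
    case False
    have "(1 + r) ^ N * exp (- t * r powr s) \<le> (1 + \<bar>R\<bar>) ^ N * 1"
      using False that assms by (intro mult_mono power_mono) auto
    then show ?thesis by (simp add: C_def)
  next
    case True
    then show ?thesis using R[OF True] unfolding C_def by linarith
  qed
  show ?thesis
  proof (rule summable_on_comparison_test)
    show "(\<lambda>k::real^'n. C * (1 / (1 + norm k) ^ N)) summable_on int_lattice"
      unfolding N_def by (intro summable_on_cmult_right summable_on_lattice_power)
    fix k :: "real^'n"
    have "0 < (1 + norm k) ^ N" by (simp add: add_pos_nonneg)
    then show "exp (- t * norm k powr s) \<le> C * (1 / (1 + norm k) ^ N)"
      using bd[of "norm k"] by (simp add: pos_le_divide_eq mult.commute)
  qed auto
qed

section \<open>Fourier coefficients and multipliers\<close>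

abbreviation char :: "real^'n \<Rightarrow> real^'n \<Rightarrow> complex" where
  "char k x \<equiv> cis (2 * pi * (k \<bullet> x))"

definition fseries :: "(real^'n \<Rightarrow> complex) \<Rightarrow> real^'n \<Rightarrow> complex" where
  "fseries a x = (\<Sum>\<^sub>\<infinity>k\<in>int_lattice. a k * char k x)"

lemma fourier_mult_fseries:
  "fourier_mult m f x = Re (fseries (\<lambda>k. complex_of_real (m (norm k)) * fourier_coeff f k) x)"
  by (simp add: fourier_mult_def fseries_def)

lemma fourier_coeff_char:
  "fourier_coeff f k = integral torus_cube (\<lambda>x. complex_of_real (f x) * char (- k) x)"
  by (simp add: fourier_coeff_def)

lemma continuous_on_char [continuous_intros]: "continuous_on A (char k)"
  by (intro continuous_intros)

lemma fourier_coeff_linear: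
  assumes u: "continuous_on torus_cube u" and v: "continuous_on torus_cube v"
  shows "fourier_coeff (\<lambda>x. \<alpha> * u x + v x) k = complex_of_real \<alpha> * fourier_coeff u k + fourier_coeff v k"
proof -
  have i: "(\<lambda>x. complex_of_real (w x) * char (- k) x) integrable_on torus_cube"
    if "continuous_on torus_cube w" for w
    using that by (intro torus_integrable continuous_intros)
  have "fourier_coeff (\<lambda>x. \<alpha> * u x + v x) k =
      integral torus_cube (\<lambda>x. complex_of_real \<alpha> * (complex_of_real (u x) * char (- k) x) + complex_of_real (v x) * char (- k) x)"
    unfolding fourier_coeff_char by (simp add: algebra_simps)
  also have "\<dots> = complex_of_real \<alpha> * fourier_coeff u k + fourier_coeff v k"
    unfolding fourier_coeff_char
    by (subst integral_add) (use i[OF u] i[OF v] in \<open>auto intro!: integrable_on_mult_right\<close>)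
  finally show ?thesis .
qed

lemma fourier_coeff_bound:
  assumes "continuous_on torus_cube f" "\<And>x. x \<in> torus_cube \<Longrightarrow> \<bar>f x\<bar> \<le> B"
  shows "norm (fourier_coeff f k) \<le> B"
  unfolding fourier_coeff_char using assms
  by (intro torus_integral_norm_bound continuous_intros) (auto simp: norm_mult)

lemma torus_bounded:
  fixes f :: "real^'n \<Rightarrow> real"
  assumes "continuous_on torus_cube f"
  obtains B where "\<And>x. x \<in> torus_cube \<Longrightarrow> \<bar>f x\<bar> \<le> B"
  using compact_imp_bounded[OF compact_continuous_image[OF assms compact_torus_cube]]
  by (auto simp: bounded_iff)

lemma integral_cnj_torus:
  fixes g :: "real^'n \<Rightarrow> complex"
  assumes "continuous_on torus_cube g"
  shows "integral torus_cube (\<lambda>x. cnj (g x)) = cnj (integral torus_cube g)"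
  using integral_linear[OF torus_integrable[OF assms] bounded_linear_cnj] by (simp add: o_def)

lemma fourier_coeff_cnj:
  assumes "continuous_on torus_cube f"
  shows "cnj (fourier_coeff f k) = fourier_coeff f (- k)"
  unfolding fourier_coeff_char using assms
  by (subst integral_cnj_torus[symmetric]) (auto intro!: continuous_intros simp: cis_cnj)

lemma fourier_coeff_0:
  assumes "continuous_on torus_cube f"
  shows "fourier_coeff f 0 = complex_of_real (integral torus_cube f)"
  unfolding fourier_coeff_char using torus_integral_complex_of_real[OF assms] by simp

section \<open>Absolutely convergent Fourier series\<close>

definition fsummable :: "(real^'n \<Rightarrow> complex) \<Rightarrow> bool" where
  "fsummable a \<longleftrightarrow> (\<lambda>k. norm (a k)) summable_on int_lattice"

lemma fsummableI:
  assumes "M summable_on int_lattice" "\<And>k. k \<in> int_lattice \<Longrightarrow> norm (a k) \<le> M k"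
  shows "fsummable a"
  unfolding fsummable_def by (rule summable_on_comparison_test[OF assms(1)]) (use assms in auto)

lemma fsummable_char:
  assumes "fsummable a"
  shows "(\<lambda>k. a k * char k x) summable_on int_lattice"
  by (rule abs_summable_summable) (use assms in \<open>simp add: fsummable_def norm_mult\<close>)

lemma continuous_on_fseries [continuous_intros]:
  assumes "fsummable a"
  shows "continuous_on X (fseries a)"
  unfolding fseries_def[abs_def]
  by (rule infsum_continuous_on[where M = "\<lambda>k. norm (a k)"])
     (use assms in \<open>auto intro!: continuous_intros simp: fsummable_def norm_mult\<close>)

lemma fseries_linear:
  assumes "fsummable a" "fsummable b"
  shows "fseries (\<lambda>k. c * a k + b k) x = c * fseries a x + fseries b x"
proof -
  have "fseries (\<lambda>k. c * a k + b k) x = (\<Sum>\<^sub>\<infinity>k\<in>int_lattice. c * (a k * char k x) + b k * char k x)"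
    by (simp add: fseries_def algebra_simps)
  also have "\<dots> = c * fseries a x + fseries b x"
    unfolding fseries_def
    by (subst infsum_add) (auto intro!: fsummable_char assms summable_on_cmult_right simp: infsum_cmult_right')
  finally show ?thesis .
qed

lemma integral_fseries_mult:
  fixes a :: "real^'n \<Rightarrow> complex"
  assumes a: "fsummable a" and g: "continuous_on torus_cube g"
  shows "integral torus_cube (\<lambda>x. fseries a x * g x) =
    (\<Sum>\<^sub>\<infinity>k\<in>int_lattice. a k * integral torus_cube (\<lambda>x. g x * char k x))"
proof -
  obtain B where B: "\<And>x. x \<in> torus_cube \<Longrightarrow> norm (g x) \<le> B"
    using compact_imp_bounded[OF compact_continuous_image[OF g compact_torus_cube]]
    by (auto simp: bounded_iff)
  have "integral torus_cube (\<lambda>x. fseries a x * g x) =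
      integral torus_cube (\<lambda>x. \<Sum>\<^sub>\<infinity>k\<in>int_lattice. a k * char k x * g x)"
    unfolding fseries_def by (subst infsum_cmult_left') simp
  also have "\<dots> = (\<Sum>\<^sub>\<infinity>k\<in>int_lattice. integral torus_cube (\<lambda>x. a k * char k x * g x))"
    by (rule torus_integral_infsum[where M = "\<lambda>k. norm (a k) * B"])
       (use a B in \<open>auto intro!: continuous_intros g summable_on_cmult_left mult_left_mono
          simp: fsummable_def norm_mult\<close>)
  also have "\<dots> = (\<Sum>\<^sub>\<infinity>k\<in>int_lattice. a k * integral torus_cube (\<lambda>x. g x * char k x))"
  proof (rule infsum_cong)
    fix k :: "real^'n"
    have "integral torus_cube (\<lambda>x. a k * char k x * g x) = integral torus_cube (\<lambda>x. a k * (g x * char k x))"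
      by (simp add: mult_ac)
    also have "\<dots> = a k * integral torus_cube (\<lambda>x. g x * char k x)" by simp
    finally show "integral torus_cube (\<lambda>x. a k * char k x * g x) = \<dots>" .
  qed
  finally show ?thesis .
qed

lemma integral_fseries_char:
  fixes a :: "real^'n \<Rightarrow> complex"
  assumes a: "fsummable a" and l: "l \<in> int_lattice"
  shows "integral torus_cube (\<lambda>x. fseries a x * char (- l) x) = a l"
proof -
  have "integral torus_cube (\<lambda>x. fseries a x * char (- l) x) =
      (\<Sum>\<^sub>\<infinity>k\<in>int_lattice. a k * integral torus_cube (\<lambda>x. char (- l) x * char k x))"
    by (rule integral_fseries_mult[OF a]) (intro continuous_intros)
  also have "\<dots> = (\<Sum>\<^sub>\<infinity>k\<in>{l}. a k)"
  proof (rule infsum_cong_neutral)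
    fix k :: "real^'n" assume k: "k \<in> int_lattice \<inter> {l}"
    then show "a k * integral torus_cube (\<lambda>x. char (- l) x * char k x) = a k"
      by (simp add: cis_mult integral_torus_const)
  next
    fix k :: "real^'n" assume k: "k \<in> int_lattice - {l}"
    have "char (- l) x * char k x = char (k - l) x" for x
      by (simp add: cis_mult inner_diff_left algebra_simps)
    then show "a k * integral torus_cube (\<lambda>x. char (- l) x * char k x) = 0"
      using k l by (simp add: integral_cis_lattice int_lattice_diff)
  qed (use l in auto)
  finally show ?thesis by simp
qed

text \<open>The real part averages the series with its conjugate, and conjugation carries the
  coefficient at \<open>- l\<close> to \<open>l\<close>. Coefficients of real functions are
  invariant under this average, so the \<open>Re\<close> in \<open>fourier_mult\<close> does them no
  harm.\<close>

lemma fourier_coeff_Re_fseries: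
  fixes a :: "real^'n \<Rightarrow> complex"
  assumes a: "fsummable a" and l: "l \<in> int_lattice"
  shows "fourier_coeff (\<lambda>x. Re (fseries a x)) l = (a l + cnj (a (- l))) / 2"
proof -
  have c: "continuous_on torus_cube (\<lambda>x. fseries a x * char k x)" for k
    by (intro continuous_intros a)
  have "fourier_coeff (\<lambda>x. Re (fseries a x)) l =
      integral torus_cube (\<lambda>x. (1/2) * (fseries a x * char (- l) x + cnj (fseries a x * char l x)))"
    unfolding fourier_coeff_char
  proof (rule integral_cong)
    fix x
    have "complex_of_real (Re (fseries a x)) = (1/2) * (fseries a x + cnj (fseries a x))"
      by (simp add: complex_eq_iff)
    then show "complex_of_real (Re (fseries a x)) * char (- l) x =
        (1/2) * (fseries a x * char (- l) x + cnj (fseries a x * char l x))"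
      by (simp add: cis_cnj algebra_simps)
  qed
  also have "\<dots> = (1/2) * (integral torus_cube (\<lambda>x. fseries a x * char (- l) x) + integral torus_cube (\<lambda>x. cnj (fseries a x * char l x)))"
    by (subst integral_mult_right, subst integral_add)
       (auto intro!: torus_integrable continuous_intros a)
  also have "\<dots> = (a l + cnj (a (- l))) / 2"
    using integral_fseries_char[OF a l] integral_fseries_char[OF a int_lattice_uminus[OF l]]
      integral_cnj_torus[OF c[of l]] by simp
  finally show ?thesis .
qed

text \<open>The symbol is a function of the radius alone, so the dimension of the lattice enters as
  a type argument.\<close>

definition msummable :: "('n::finite) itself \<Rightarrow> (real \<Rightarrow> real) \<Rightarrow> bool" where
  "msummable _ m \<longleftrightarrow> (\<lambda>k::real^'n. \<bar>m (norm k)\<bar>) summable_on int_lattice"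

lemma fsummable_mult_coeff:
  fixes f :: "real^'n \<Rightarrow> real"
  assumes m: "msummable TYPE('n) m" and f: "continuous_on torus_cube f"
  shows "fsummable (\<lambda>k. complex_of_real (m (norm k)) * fourier_coeff f k)"
proof -
  obtain B where B: "\<And>x. x \<in> torus_cube \<Longrightarrow> \<bar>f x\<bar> \<le> B" using torus_bounded[OF f] by blast
  show ?thesis
    by (rule fsummableI[where M = "\<lambda>k. \<bar>m (norm k)\<bar> * B"])
       (use m fourier_coeff_bound[OF f B] in \<open>auto simp: msummable_def norm_mult
          intro!: summable_on_cmult_left mult_left_mono\<close>)
qed

lemma continuous_on_fourier_mult:
  fixes f :: "real^'n \<Rightarrow> real"
  assumes m: "msummable TYPE('n) m" and f: "continuous_on torus_cube f"
  shows "continuous_on X (fourier_mult m f)"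
  unfolding fourier_mult_fseries[abs_def]
  by (intro continuous_intros fsummable_mult_coeff assms)

lemma fourier_mult_linear:
  fixes u v :: "real^'n \<Rightarrow> real"
  assumes m: "msummable TYPE('n) m" and u: "continuous_on torus_cube u" and v: "continuous_on torus_cube v"
  shows "fourier_mult m (\<lambda>x. \<alpha> * u x + v x) y = \<alpha> * fourier_mult m u y + fourier_mult m v y"
proof -
  have "fourier_mult m (\<lambda>x. \<alpha> * u x + v x) y =
     Re (fseries (\<lambda>k. complex_of_real \<alpha> * (complex_of_real (m (norm k)) * fourier_coeff u k)
        + complex_of_real (m (norm k)) * fourier_coeff v k) y)"
    unfolding fourier_mult_fseries unfolding fourier_coeff_linear[OF u v] by (simp add: algebra_simps)
  also have "\<dots> = \<alpha> * fourier_mult m u y + fourier_mult m v y"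
    unfolding fourier_mult_fseries by (subst fseries_linear) (auto intro!: fsummable_mult_coeff m u v)
  finally show ?thesis .
qed

lemma fourier_coeff_fourier_mult:
  fixes f :: "real^'n \<Rightarrow> real"
  assumes m: "msummable TYPE('n) m" and f: "continuous_on torus_cube f" and l: "l \<in> int_lattice"
  shows "fourier_coeff (fourier_mult m f) l = complex_of_real (m (norm l)) * fourier_coeff f l"
proof -
  have "fourier_coeff (fourier_mult m f) l = (complex_of_real (m (norm l)) * fourier_coeff f l
     + cnj (complex_of_real (m (norm (- l))) * fourier_coeff f (- l))) / 2"
    unfolding fourier_mult_fseries[abs_def]
    by (rule fourier_coeff_Re_fseries[OF fsummable_mult_coeff[OF m f] l])
  also have "cnj (fourier_coeff f (- l)) = fourier_coeff f l"
    using fourier_coeff_cnj[OF f, of "- l"] by simp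
  then have "cnj (complex_of_real (m (norm (- l))) * fourier_coeff f (- l)) = complex_of_real (m (norm l)) * fourier_coeff f l"
    by simp
  finally show ?thesis by simp
qed

text \<open>Two separate conditionals cover the degenerate frequency \<open>j = 0\<close>: there
  both fire and their average is \<open>Re c\<close>.\<close>

lemma fourier_coeff_Re_char:
  fixes j :: "real^'n"
  assumes j: "j \<in> int_lattice" and l: "l \<in> int_lattice"
  shows "fourier_coeff (\<lambda>x. Re (c * char j x)) l = ((if l = j then c else 0) + (if l = - j then cnj c else 0)) / 2"
proof -
  define a where "a = (\<lambda>k. if k = j then c else 0)"
  have fs: "fseries a x = c * char j x" for x
  proof -
    have "fseries a x = (\<Sum>\<^sub>\<infinity>k\<in>{j}. a k * char k x)"
      unfolding fseries_def by (rule infsum_cong_neutral) (use j in \<open>auto simp: a_def\<close>)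
    then show ?thesis by (simp add: a_def)
  qed
  have "fsummable a" unfolding fsummable_def
    by (rule finite_nonzero_values_imp_summable_on, rule finite_subset[of _ "{j}"]) (auto simp: a_def)
  from fourier_coeff_Re_fseries[OF this l] show ?thesis
    unfolding fs by (auto simp: a_def minus_equation_iff)
qed

text \<open>Real characters are eigenfunctions. With \<open>j = 0\<close> this gives the action on
  constants, with \<open>j\<close> a unit vector the action on the test functions of the Korovkin
  argument.\<close>

lemma fourier_mult_Re_char:
  fixes j :: "real^'n"
  assumes j: "j \<in> int_lattice"
  shows "fourier_mult m (\<lambda>x. Re (c * char j x)) x = m (norm j) * Re (c * char j x)"
proof -
  let ?u = "\<lambda>k. (m (norm k) * ((if k = j then c else 0) + (if k = - j then cnj c else 0)) / 2) * char k x"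
  have "(\<Sum>\<^sub>\<infinity>k\<in>int_lattice. complex_of_real (m (norm k)) * fourier_coeff (\<lambda>x. Re (c * char j x)) k * char k x)
     = (\<Sum>\<^sub>\<infinity>k\<in>int_lattice. ?u k)"
    by (rule infsum_cong) (simp only: fourier_coeff_Re_char[OF j] times_divide_eq_right)
  also have "\<dots> = (\<Sum>\<^sub>\<infinity>k\<in>{j, - j}. ?u k)"
    by (rule infsum_cong_neutral) (use j int_lattice_uminus[OF j] in auto)
  also have "\<dots> = (\<Sum>k\<in>{j, - j}. ?u k)" by simp
  also have "Re \<dots> = m (norm j) * Re (c * char j x)"
  proof (cases "j = - j")
    case True
    then have "j = 0" by (simp add: vec_eq_iff)
    then show ?thesis by simp
  next
    case False
    then have "j \<noteq> 0" by auto
    have eq: "- j = j \<longleftrightarrow> False" "j = - j \<longleftrightarrow> False" using False by metis+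
    show ?thesis using eq by (simp add: algebra_simps)
  qed
  finally show ?thesis unfolding fourier_mult_def .
qed

lemma fourier_mult_const:
  assumes "m 0 = 1"
  shows "fourier_mult m (\<lambda>x. c) x = c"
  using fourier_mult_Re_char[OF int_lattice_0, of m "complex_of_real c" x] assms by simp

lemma fourier_mult_mult:
  fixes f :: "real^'n \<Rightarrow> real"
  assumes m: "msummable TYPE('n) m" and f: "continuous_on torus_cube f"
  shows "fourier_mult m' (fourier_mult m f) x = fourier_mult (\<lambda>r. m' r * m r) f x"
  unfolding fourier_mult_def[of m'] fourier_mult_def[of "\<lambda>r. m' r * m r"]
  by (intro arg_cong[where f = Re] infsum_cong)
     (simp add: fourier_coeff_fourier_mult[OF m f] mult.assoc)

lemma integral_fourier_mult:
  fixes f :: "real^'n \<Rightarrow> real"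
  assumes m: "msummable TYPE('n) m" "m 0 = 1" and f: "continuous_on torus_cube f"
  shows "integral torus_cube (fourier_mult m f) = integral torus_cube f"
proof -
  have "complex_of_real (integral torus_cube (fourier_mult m f)) = fourier_coeff (fourier_mult m f) 0"
    by (rule fourier_coeff_0[symmetric]) (rule continuous_on_fourier_mult[OF m(1) f])
  also have "\<dots> = complex_of_real (integral torus_cube f)"
    using m f by (simp add: fourier_coeff_fourier_mult int_lattice_0 fourier_coeff_0)
  finally show ?thesis by simp
qed

text \<open>The squared distance between \<open>f\<close> and its partial sum \<open>p\<close> has a
  nonnegative integral. Both its cross term and the square of \<open>p\<close> integrate to
  \<open>?A\<close>, which leaves the difference of the two sides.\<close>

lemma Bessel_inequality:
  fixes f :: "real^'n \<Rightarrow> real"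
  assumes f: "continuous_on torus_cube f" and S: "finite S" "S \<subseteq> int_lattice"
  shows "(\<Sum>k\<in>S. (norm (fourier_coeff f k))\<^sup>2) \<le> integral torus_cube (\<lambda>x. (f x)\<^sup>2)"
proof -
  define F where "F = fourier_coeff f"
  define p where "p = (\<lambda>x. \<Sum>k\<in>S. F k * char k x)"
  have pc: "continuous_on torus_cube p" unfolding p_def by (intro continuous_intros)
  let ?A = "complex_of_real (\<Sum>k\<in>S. (norm (F k))\<^sup>2)"
  have i1: "integral torus_cube (\<lambda>x. complex_of_real (f x) * cnj (p x)) = ?A"
  proof -
    have "integral torus_cube (\<lambda>x. complex_of_real (f x) * cnj (p x)) =
      integral torus_cube (\<lambda>x. \<Sum>k\<in>S. cnj (F k) * (complex_of_real (f x) * char (- k) x))"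
      by (simp add: p_def sum_distrib_left cis_cnj mult_ac)
    also have "\<dots> = (\<Sum>k\<in>S. integral torus_cube (\<lambda>x. cnj (F k) * (complex_of_real (f x) * char (- k) x)))"
      by (rule integral_sum[OF S(1)]) (auto intro!: torus_integrable continuous_intros f)
    also have "\<dots> = (\<Sum>k\<in>S. cnj (F k) * F k)"
      by (simp add: F_def fourier_coeff_char)
    finally show ?thesis by (simp add: complex_norm_square mult.commute del: of_real_power)
  qed
  have i2: "integral torus_cube (\<lambda>x. p x * cnj (p x)) = ?A"
  proof -
    have "integral torus_cube (\<lambda>x. p x * cnj (p x)) =
      integral torus_cube (\<lambda>x. \<Sum>k\<in>S. \<Sum>l\<in>S. F k * cnj (F l) * char (k - l) x)"
      unfolding p_def cnj_sum sum_product
      by (intro integral_cong sum.cong refl)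
         (simp add: cis_cnj inner_diff_left right_diff_distrib divide_inverse mult_ac flip: cis_divide cis_inverse)
    also have "\<dots> = (\<Sum>k\<in>S. \<Sum>l\<in>S. integral torus_cube (\<lambda>x. F k * cnj (F l) * char (k - l) x))"
      using S(1) by (subst integral_sum, simp, intro torus_integrable continuous_intros, intro sum.cong refl integral_sum)
         (auto intro!: torus_integrable continuous_intros)
    also have "\<dots> = (\<Sum>k\<in>S. \<Sum>l\<in>S. if l = k then F k * cnj (F k) else 0)"
      using S by (intro sum.cong refl) (auto simp: integral_cis_lattice int_lattice_diff subset_eq)
    also have "\<dots> = (\<Sum>k\<in>S. F k * cnj (F k))" using S by (simp add: sum.delta)
    finally show ?thesis by (simp add: complex_norm_square del: of_real_power)
  qed
  let ?I = "integral torus_cube (\<lambda>x. (norm (complex_of_real (f x) - p x))\<^sup>2)"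
  have nonneg: "0 \<le> ?I"
    by (rule integral_nonneg) (auto intro!: torus_integrable continuous_intros f pc)
  have "complex_of_real ?I = integral torus_cube (\<lambda>x. complex_of_real ((norm (complex_of_real (f x) - p x))\<^sup>2))"
    by (rule torus_integral_complex_of_real[symmetric]) (intro continuous_intros f pc)
  also have "\<dots> = integral torus_cube (\<lambda>x. complex_of_real ((f x)\<^sup>2) - complex_of_real (f x) * cnj (p x)
        - cnj (complex_of_real (f x) * cnj (p x)) + p x * cnj (p x))"
    by (intro integral_cong, unfold complex_norm_square) (simp add: power2_eq_square algebra_simps)
  also have "\<dots> = integral torus_cube (\<lambda>x. complex_of_real ((f x)\<^sup>2)) - ?A - cnj ?A + ?A"
  proof (rule integral_unique)
    have hi: "(g has_integral integral torus_cube g) torus_cube" if "continuous_on torus_cube g" for g :: "real^'n \<Rightarrow> complex"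
      using that by (simp add: integrable_integral torus_integrable)
    have c1: "continuous_on torus_cube (\<lambda>x. complex_of_real (f x) * cnj (p x))"
      by (intro continuous_intros f pc)
    have "((\<lambda>x. cnj (complex_of_real (f x) * cnj (p x))) has_integral cnj ?A) torus_cube"
      using hi[OF continuous_on_cnj[OF c1]] unfolding integral_cnj_torus[OF c1] i1 .
    moreover have "((\<lambda>x. p x * cnj (p x)) has_integral ?A) torus_cube"
      using hi[OF continuous_on_mult[OF pc continuous_on_cnj[OF pc]]] unfolding i2 .
    moreover have "((\<lambda>x. complex_of_real ((f x)\<^sup>2)) has_integral
        integral torus_cube (\<lambda>x. complex_of_real ((f x)\<^sup>2))) torus_cube"
      by (intro hi continuous_intros f)
    ultimately show "((\<lambda>x. complex_of_real ((f x)\<^sup>2) - complex_of_real (f x) * cnj (p x)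
        - cnj (complex_of_real (f x) * cnj (p x)) + p x * cnj (p x)) has_integral
        integral torus_cube (\<lambda>x. complex_of_real ((f x)\<^sup>2)) - ?A - cnj ?A + ?A) torus_cube"
      using hi[OF c1] unfolding i1 by (intro has_integral_add has_integral_diff)
  qed
  also have "\<dots> = complex_of_real (integral torus_cube (\<lambda>x. (f x)\<^sup>2) - (\<Sum>k\<in>S. (norm (F k))\<^sup>2))"
    by (subst torus_integral_complex_of_real) (auto intro!: continuous_intros f)
  finally have "?I = integral torus_cube (\<lambda>x. (f x)\<^sup>2) - (\<Sum>k\<in>S. (norm (F k))\<^sup>2)"
    unfolding of_real_eq_iff .
  with nonneg show ?thesis by (simp add: F_def)
qed

section \<open>Positivity-preserving multipliers\<close>

text \<open>A substitute for being the transform of a positive measure. Only finite sums occur, so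
  no convergence question arises. The frequencies are arbitrary vectors and the coefficients need no
  symmetry; only the real part is tested.\<close>

definition pos_mult :: "(real^'n \<Rightarrow> real) \<Rightarrow> bool" where
  "pos_mult m \<longleftrightarrow> (\<forall>S a. finite S \<longrightarrow> (\<forall>x. 0 \<le> Re (\<Sum>k\<in>S. a k * char k x)) \<longrightarrow>
     (\<forall>x. 0 \<le> Re (\<Sum>k\<in>S. complex_of_real (m k) * a k * char k x)))"

lemma pos_multD:
  "pos_mult m \<Longrightarrow> finite S \<Longrightarrow> (\<And>x. 0 \<le> Re (\<Sum>k\<in>S. a k * char k x)) \<Longrightarrow>
     0 \<le> Re (\<Sum>k\<in>S. complex_of_real (m k) * a k * char k x)"
  unfolding pos_mult_def by blast

lemma pos_mult_const: "0 \<le> c \<Longrightarrow> pos_mult (\<lambda>_. c)"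
  unfolding pos_mult_def by (simp add: mult.assoc flip: sum_distrib_left)

lemma pos_mult_mult:
  fixes m m' :: "real^'n \<Rightarrow> real"
  assumes "pos_mult m" "pos_mult m'"
  shows "pos_mult (\<lambda>k. m k * m' k)"
  unfolding pos_mult_def
proof (intro allI impI)
  fix S :: "(real^'n) set" and a x
  assume S: "finite S" and a: "\<forall>x. 0 \<le> Re (\<Sum>k\<in>S. a k * char k x)"
  have "0 \<le> Re (\<Sum>k\<in>S. complex_of_real (m k) * (complex_of_real (m' k) * a k) * char k x)"
    by (rule pos_multD[OF assms(1) S pos_multD[OF assms(2) S]]) (use a in blast)
  then show "0 \<le> Re (\<Sum>k\<in>S. complex_of_real (m k * m' k) * a k * char k x)"
    by (simp add: mult.assoc)
qed

lemma pos_mult_add: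
  fixes m m' :: "real^'n \<Rightarrow> real"
  assumes "pos_mult m" "pos_mult m'"
  shows "pos_mult (\<lambda>k. m k + m' k)"
  unfolding pos_mult_def
proof (intro allI impI)
  fix S :: "(real^'n) set" and a x
  assume S: "finite S" and a: "\<forall>x. 0 \<le> Re (\<Sum>k\<in>S. a k * char k x)"
  have "0 \<le> Re (\<Sum>k\<in>S. complex_of_real (m k) * a k * char k x)"
    "0 \<le> Re (\<Sum>k\<in>S. complex_of_real (m' k) * a k * char k x)"
    using a by (auto intro: pos_multD[OF assms(1) S] pos_multD[OF assms(2) S] simp del: Re_sum)
  moreover have "(\<Sum>k\<in>S. complex_of_real (m k + m' k) * a k * char k x) =
      (\<Sum>k\<in>S. complex_of_real (m k) * a k * char k x) + (\<Sum>k\<in>S. complex_of_real (m' k) * a k * char k x)"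
    by (simp add: algebra_simps sum.distrib)
  ultimately show "0 \<le> Re (\<Sum>k\<in>S. complex_of_real (m k + m' k) * a k * char k x)"
    unfolding plus_complex.sel by simp
qed

lemma pos_mult_sum: "(\<And>i. i \<in> I \<Longrightarrow> pos_mult (m i)) \<Longrightarrow> pos_mult (\<lambda>k. \<Sum>i\<in>I. m i k)"
  by (induction I rule: infinite_finite_induct) (auto intro: pos_mult_add pos_mult_const)

lemma pos_mult_prod: "(\<And>i. i \<in> I \<Longrightarrow> pos_mult (m i)) \<Longrightarrow> pos_mult (\<lambda>k. \<Prod>i\<in>I. m i k)"
  by (induction I rule: infinite_finite_induct) (auto intro: pos_mult_mult pos_mult_const)

lemma pos_mult_power: "pos_mult m \<Longrightarrow> pos_mult (\<lambda>k. m k ^ n)"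
  by (induction n) (auto intro: pos_mult_mult pos_mult_const)

text \<open>Positivity of a multiplier involves finitely many frequencies at a time, so pointwise
  convergence of the symbols is enough.\<close>

lemma pos_mult_limit:
  fixes M :: "real^'n \<Rightarrow> real"
  assumes lim: "\<And>k. ((\<lambda>n. m n k) \<longlongrightarrow> M k) F" and pos: "\<forall>\<^sub>F n in F. pos_mult (m n)" and F: "F \<noteq> bot"
  shows "pos_mult M"
  unfolding pos_mult_def
proof (intro allI impI)
  fix S :: "(real^'n) set" and a x
  assume S: "finite S" and a: "\<forall>x. 0 \<le> Re (\<Sum>k\<in>S. a k * char k x)"
  have "((\<lambda>n. Re (\<Sum>k\<in>S. complex_of_real (m n k) * a k * char k x)) \<longlongrightarrow>
      Re (\<Sum>k\<in>S. complex_of_real (M k) * a k * char k x)) F"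
    by (intro tendsto_intros lim)
  moreover have "\<forall>\<^sub>F n in F. 0 \<le> Re (\<Sum>k\<in>S. complex_of_real (m n k) * a k * char k x)"
    using pos by eventually_elim (rule pos_multD[OF _ S], use a in auto)
  ultimately show "0 \<le> Re (\<Sum>k\<in>S. complex_of_real (M k) * a k * char k x)"
    using F by (rule tendsto_lowerbound)
qed

lemma pos_mult_suminf:
  assumes "\<And>n. pos_mult (m n)" "\<And>k. (\<lambda>n. m n k) sums M k"
  shows "pos_mult M"
  by (rule pos_mult_limit[where m = "\<lambda>N k. \<Sum>n<N. m n k" and F = sequentially])
     (use assms in \<open>auto simp: sums_def intro!: pos_mult_sum always_eventually\<close>)

text \<open>The exponential series has nonnegative coefficients. Up to normalisation this is the
  symbol of a compound Poisson law.\<close>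

lemma pos_mult_exp:
  assumes "pos_mult m" "0 \<le> c"
  shows "pos_mult (\<lambda>k. exp (c * m k))"
proof (rule pos_mult_suminf)
  show "pos_mult (\<lambda>k. (c ^ n / fact n) * m k ^ n)" for n
    using assms by (intro pos_mult_mult pos_mult_const pos_mult_power) auto
  show "(\<lambda>n. (c ^ n / fact n) * m k ^ n) sums exp (c * m k)" for k
    using exp_converges[of "c * m k"] by (simp add: power_mult_distrib scaleR_conv_of_real divide_inverse mult_ac)
qed

text \<open>The symbol \<open>cos (\<theta> k\<^sub>i)\<close> is the average of two translations.\<close>

lemma pos_mult_cos: "pos_mult (\<lambda>k::real^'n. cos (\<theta> * k $ i))"
  unfolding pos_mult_def
proof (intro allI impI)
  fix S :: "(real^'n) set" and a x
  assume S: "finite S" and a: "\<forall>x. 0 \<le> Re (\<Sum>k\<in>S. a k * char k x)"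
  define v where "v = axis i (\<theta> / (2 * pi))"
  have "complex_of_real (cos (\<theta> * k $ i)) * a k * char k x = (a k * char k (x + v) + a k * char k (x - v)) / 2" for k
  proof -
    have "char k (x + v) = char k x * cis (\<theta> * k $ i)" "char k (x - v) = char k x * cis (- (\<theta> * k $ i))"
      by (simp_all add: cis_mult v_def inner_add_right inner_diff_right inner_axis algebra_simps)
    moreover have "cis (\<theta> * k $ i) + cis (- (\<theta> * k $ i)) = 2 * complex_of_real (cos (\<theta> * k $ i))"
      by (simp add: complex_eq_iff)
    ultimately have "a k * char k (x + v) + a k * char k (x - v) = a k * char k x * (2 * complex_of_real (cos (\<theta> * k $ i)))"
      by (metis (no_types, lifting) distrib_left mult.assoc)
    then show ?thesis by simp
  qed
  then have "(\<Sum>k\<in>S. complex_of_real (cos (\<theta> * k $ i)) * a k * char k x) =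
      ((\<Sum>k\<in>S. a k * char k (x + v)) + (\<Sum>k\<in>S. a k * char k (x - v))) / 2"
    by (simp only: sum.distrib flip: sum_divide_distrib)
  also have "Re \<dots> = (Re (\<Sum>k\<in>S. a k * char k (x + v)) + Re (\<Sum>k\<in>S. a k * char k (x - v))) / 2"
    by (simp only: Re_divide_numeral plus_complex.sel)
  also have "\<dots> \<ge> 0" using a by (intro divide_nonneg_pos add_nonneg_nonneg zero_less_numeral) blast+
  finally show "0 \<le> Re (\<Sum>k\<in>S. complex_of_real (cos (\<theta> * k $ i)) * a k * char k x)" .
qed

text \<open>The central limit theorem for the two-point distribution turns cosines into Gaussians.\<close>

lemma pos_mult_gauss_coord:
  assumes "0 \<le> l"
  shows "pos_mult (\<lambda>k::real^'n. exp (- l * (k $ i)\<^sup>2))"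
proof (rule pos_mult_limit)
  show "\<forall>\<^sub>F n::nat in sequentially. pos_mult (\<lambda>k::real^'n. cos (sqrt (2 * l) / sqrt (real n) * k $ i) ^ n)"
    by (intro always_eventually allI pos_mult_power pos_mult_cos)
  show "(\<lambda>n. cos (sqrt (2 * l) / sqrt (real n) * k $ i) ^ n) \<longlonglongrightarrow> exp (- l * (k $ i)\<^sup>2)" for k :: "real^'n"
  proof (cases "sqrt (2 * l) * k $ i = 0")
    case False
    \<comment> \<open>To leading order each factor is \<open>1 - l * (k $ i)^2 / n\<close>, whose
      \<open>n\<close>-th power tends to the Gaussian. Since the cosine is even, its argument may be
      replaced by a positive one, which fixes the sign for the asymptotics.\<close>
    define a where "a = \<bar>sqrt (2 * l) * k $ i\<bar>"
    have "a > 0" using False by (simp add: a_def)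
    then have "(\<lambda>n. cos (a / sqrt (real n)) ^ n) \<longlonglongrightarrow> exp (- (a\<^sup>2 / 2))"
      unfolding power2_eq_square by real_asymp
    moreover have "a\<^sup>2 / 2 = l * (k $ i)\<^sup>2" using assms by (simp add: a_def power_mult_distrib)
    moreover have "cos (a / sqrt (real n)) = cos (sqrt (2 * l) / sqrt (real n) * k $ i)" for n
    proof -
      have "a / sqrt (real n) = \<bar>sqrt (2 * l) / sqrt (real n) * k $ i\<bar>"
        by (simp add: a_def abs_mult)
      then show ?thesis by (simp only: cos_abs_real)
    qed
    ultimately show ?thesis by simp
  next
    case True
    then show ?thesis by auto
  qed
qed simp

lemma pos_mult_gauss:
  assumes "0 \<le> l"
  shows "pos_mult (\<lambda>k::real^'n. exp (- l * (norm k)\<^sup>2))"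
proof -
  have "pos_mult (\<lambda>k::real^'n. \<Prod>i\<in>UNIV. exp (- l * (k $ i)\<^sup>2))"
    by (intro pos_mult_prod pos_mult_gauss_coord assms)
  also have "(\<lambda>k::real^'n. \<Prod>i\<in>UNIV. exp (- l * (k $ i)\<^sup>2)) = (\<lambda>k. exp (- l * (norm k)\<^sup>2))"
    by (simp add: norm_vec_def L2_set_def sum_nonneg sum_distrib_left sum_negf flip: exp_sum)
  finally show ?thesis .
qed

text \<open>Successive values differ by the factor \<open>(Suc n - b) / Suc (Suc n)\<close>,
  nonnegative for \<open>b \<le> 1\<close>, and the first value is \<open>- b\<close>. With
  \<open>b = s / 2\<close> this is the point where positivity uses \<open>s \<le> 2\<close>.\<close>

lemma gbinomial_alternating_nonpos:
  fixes b :: real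
  assumes "0 \<le> b" "b \<le> 1"
  shows "(-1) ^ Suc n * (b gchoose Suc n) \<le> 0"
proof (induction n)
  case (Suc n)
  have "real (Suc (Suc n)) * (b gchoose Suc (Suc n)) = (b - real (Suc n)) * (b gchoose Suc n)"
    using gbinomial_mult_1[of b "Suc n"] by (simp add: algebra_simps)
  then have e: "(b gchoose Suc (Suc n)) = (b - real (Suc n)) * (b gchoose Suc n) / real (Suc (Suc n))"
    by (simp add: eq_divide_eq mult.commute del: of_nat_Suc)
  have "(-1) ^ Suc (Suc n) * (b gchoose Suc (Suc n)) =
     ((real (Suc n) - b) / real (Suc (Suc n))) * ((-1) ^ Suc n * (b gchoose Suc n))"
    by (subst e) (simp add: algebra_simps diff_divide_distrib del: of_nat_Suc)
  also have "\<dots> \<le> 0" by (intro mult_nonneg_nonpos Suc) (use assms in auto)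
  finally show ?case .
qed (use assms in simp)

text \<open>Subordination without integrals: \<open>y powr b\<close> is the limit of \<open>((1 - z) / \<epsilon>) powr b\<close> with
  \<open>z = exp (- \<epsilon> (y + \<epsilon>))\<close>, and \<open>1 - (1 - z) powr b\<close> is a power series in \<open>z\<close> with nonnegative
  coefficients. The extra \<open>\<epsilon>\<close> keeps \<open>z\<close> inside the open unit disc.\<close>

lemma pos_mult_stable:
  fixes s t :: real
  assumes "0 < s" "s \<le> 2" "0 \<le> t"
  shows "pos_mult (\<lambda>k::real^'n. exp (- t * norm k powr s))"
proof -
  define b where "b = s / 2"
  have b: "0 < b" "b \<le> 1" using assms by (auto simp: b_def)
  define z where "z = (\<lambda>e (k::real^'n). exp (- (e * ((norm k)\<^sup>2 + e))))"
  have z: "pos_mult (z e)" if "e > 0" for e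
  proof -
    have "pos_mult (\<lambda>k::real^'n. exp (- (e * e)) * exp (- e * (norm k)\<^sup>2))"
      using that by (intro pos_mult_mult pos_mult_const pos_mult_gauss) auto
    then show ?thesis by (simp add: z_def[abs_def] algebra_simps flip: exp_add)
  qed
  have z1: "0 < z e k" "z e k < 1" if "e > 0" for e k
    using that by (auto simp: z_def intro!: mult_pos_pos add_nonneg_pos)
  have Q: "pos_mult (\<lambda>k. 1 - (1 - z e k) powr b)" if e: "e > 0" for e
  proof (rule pos_mult_suminf)
    show "pos_mult (\<lambda>k. - ((-1) ^ Suc n * (b gchoose Suc n)) * z e k ^ Suc n)" for n
      using gbinomial_alternating_nonpos[of b n] b
      by (intro pos_mult_mult pos_mult_const pos_mult_power z e) auto
    fix k
    have "(\<lambda>n. (b gchoose n) * (- z e k) ^ n) sums (1 + - z e k) powr b"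
      using z1[OF e, of k] by (intro gen_binomial_real) auto
    then have "(\<lambda>n. (b gchoose Suc n) * (- z e k) ^ Suc n) sums ((1 - z e k) powr b - 1)"
      by (subst sums_Suc_iff) simp
    then have "(\<lambda>n. - ((b gchoose Suc n) * (- z e k) ^ Suc n)) sums (1 - (1 - z e k) powr b)"
      using sums_minus by fastforce
    moreover have "- ((b gchoose Suc n) * (- z e k) ^ Suc n) = - ((-1) ^ Suc n * (b gchoose Suc n)) * z e k ^ Suc n" for n
      by (subst power_minus) (simp only: mult_ac mult_minus_left mult_minus_right)
    ultimately show "(\<lambda>n. - ((-1) ^ Suc n * (b gchoose Suc n)) * z e k ^ Suc n) sums (1 - (1 - z e k) powr b)"
      by (simp only:)
  qed
  have E: "pos_mult (\<lambda>k. exp (- t * ((1 - z e k) / e) powr b))" if e: "e > 0" for e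
  proof -
    \<comment> \<open>Exponentials preserve positivity for nonnegative factors only. The negative
      exponent is therefore written as a constant \<open>exp (- T)\<close> times the exponential of
      \<open>T\<close> times the positive multiplier \<open>1 - (1 - z e k) powr b\<close>.\<close>
    define T where "T = t / e powr b"
    have T: "T \<ge> 0" using assms by (simp add: T_def)
    have "pos_mult (\<lambda>k. exp (- T) * exp (T * (1 - (1 - z e k) powr b)))"
      by (intro pos_mult_mult pos_mult_const pos_mult_exp Q e T) auto
    moreover have "exp (- T) * exp (T * (1 - (1 - z e k) powr b)) = exp (- t * ((1 - z e k) / e) powr b)" for k
      using e z1[OF e, of k] by (simp add: T_def powr_divide algebra_simps flip: exp_add)
    ultimately show ?thesis by simp
  qed
  show ?thesis
  proof (rule pos_mult_limit)
    show "\<forall>\<^sub>F e in at_right 0. pos_mult (\<lambda>k::real^'n. exp (- t * ((1 - z e k) / e) powr b))"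
      using eventually_at_right_less[of 0] by eventually_elim (rule E)
    fix k :: "real^'n"
    have "((\<lambda>e. (1 - exp (- (e * (y + e)))) / e) \<longlongrightarrow> y) (at_right 0)" for y :: real
      by real_asymp
    then have "((\<lambda>e. (1 - z e k) / e) \<longlongrightarrow> (norm k)\<^sup>2) (at_right 0)"
      unfolding z_def .
    moreover have "\<forall>\<^sub>F e in at_right 0. 0 \<le> (1 - z e k) / e"
      using eventually_at_right_less[of 0] by eventually_elim (use z1 in \<open>auto intro: less_imp_le\<close>)
    ultimately have "((\<lambda>e. ((1 - z e k) / e) powr b) \<longlongrightarrow> (norm k)\<^sup>2 powr b) (at_right 0)"
      using b by (intro tendsto_powr' tendsto_const) auto
    moreover have "(norm k)\<^sup>2 powr b = norm k powr s"
      by (simp add: b_def powr_powr flip: powr_numeral)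
    ultimately show "((\<lambda>e. exp (- t * ((1 - z e k) / e) powr b)) \<longlongrightarrow> exp (- t * norm k powr s)) (at_right 0)"
      by (auto intro!: tendsto_intros)
  qed simp
qed

section \<open>Fejer summation\<close>

lemma bij_betw_vec_PiE: "bij_betw (\<lambda>k::real^'n. ($) k) {k. \<forall>i. k $ i \<in> A i} (PiE UNIV A)"
  by (rule bij_betw_byWitness[where f' = vec_lambda]) auto

lemma card_vec_box:
  assumes "\<And>i. finite (A i)"
  shows "finite {k::real^'n. \<forall>i. k $ i \<in> A i}" "card {k::real^'n. \<forall>i. k $ i \<in> A i} = (\<Prod>i\<in>UNIV. card (A i))"
  using bij_betw_finite[OF bij_betw_vec_PiE[of A]] bij_betw_same_card[OF bij_betw_vec_PiE[of A]] assms
  by (simp_all add: finite_PiE card_PiE)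

definition lattice_box :: "nat \<Rightarrow> (real^'n) set" where
  "lattice_box N = {k. \<forall>i. k $ i \<in> real ` {..<N}}"

lemma finite_lattice_box: "finite (lattice_box N)"
  and card_lattice_box: "card (lattice_box N :: (real^'n) set) = N ^ CARD('n)"
  unfolding lattice_box_def by (auto simp: card_vec_box card_image)

lemma lattice_box_subset: "(lattice_box N :: (real^'n) set) \<subseteq> int_lattice"
proof
  fix k :: "real^'n" assume "k \<in> lattice_box N"
  then have "k $ i \<in> \<int>" for i by (auto simp: lattice_box_def dest!: spec[of _ i])
  then show "k \<in> int_lattice" by (simp add: int_lattice_def)
qed

text \<open>Divided by the size of the box these are the Fejer weights: at a lattice point, the
  product over the coordinates of the positive parts of
  \<open>1 - \<bar>k $ i\<bar> / N\<close>.\<close>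

definition diff_count :: "nat \<Rightarrow> real^'n \<Rightarrow> nat" where
  "diff_count N k = card {jl \<in> lattice_box N \<times> lattice_box N. fst jl - snd jl = k}"

lemma diff_count_conv: "diff_count N k = card {j \<in> lattice_box N. j - k \<in> lattice_box N}"
  unfolding diff_count_def
  by (rule bij_betw_same_card[of fst], rule bij_betw_byWitness[where f' = "\<lambda>j. (j, j - k)"]) auto

lemma diff_count_le: "diff_count N k \<le> card (lattice_box N :: (real^'n) set)" for k :: "real^'n"
  unfolding diff_count_conv by (intro card_mono finite_lattice_box) auto

lemma diff_count_tendsto:
  fixes k :: "real^'n"
  assumes "k \<in> int_lattice"
  shows "(\<lambda>N. real (diff_count N k) / real (card (lattice_box N :: (real^'n) set))) \<longlonglongrightarrow> 1"
proof -
  have "\<forall>i. \<exists>z. k $ i = of_int z" using assms by (auto simp: int_lattice_def Ints_def)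
  then obtain z where z: "\<And>i. k $ i = of_int (z i)" by metis
  define A where "A = (\<lambda>N i. {a \<in> real ` {..<N}. a - k $ i \<in> real ` {..<N}})"
  have dc: "diff_count N k = (\<Prod>i\<in>UNIV. card (A N i))" for N
  proof -
    have "{j \<in> lattice_box N. j - k \<in> lattice_box N} = {j. \<forall>i. j $ i \<in> A N i}"
      by (auto simp: lattice_box_def A_def)
    moreover have "finite (A N i)" for i by (auto simp: A_def)
    ultimately show ?thesis by (simp add: diff_count_conv card_vec_box)
  qed
  have cA: "card (A N i) = nat (int N - \<bar>z i\<bar>)" for N i
  proof -
    \<comment> \<open>Both \<open>a\<close> and \<open>a - k $ i\<close> must lie in
      \<open>{0..<N}\<close>: an intersection of two integer intervals, of length
      \<open>N - \<bar>z i\<bar>\<close> or empty.\<close>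
    have "A N i = real_of_int ` {max 0 (z i)..<min (int N) (int N + z i)}"
    proof (intro equalityI subsetI)
      fix a assume "a \<in> A N i"
      then obtain m n where a: "a = real m" "m < N" "a - k $ i = real n" "n < N" by (auto simp: A_def)
      then have "int m - z i = int n" unfolding z
        by (metis of_int_diff of_int_eq_iff of_int_of_nat_eq)
      then have "int m \<in> {max 0 (z i)..<min (int N) (int N + z i)}" using a by auto
      moreover have "a = real_of_int (int m)" using a by simp
      ultimately show "a \<in> real_of_int ` {max 0 (z i)..<min (int N) (int N + z i)}" by blast
    next
      fix a assume "a \<in> real_of_int ` {max 0 (z i)..<min (int N) (int N + z i)}"
      then obtain w where w: "a = of_int w" "0 \<le> w" "z i \<le> w" "w < int N" "w < int N + z i" by auto
      have "a = real (nat w)" "nat w < N" "a - k $ i = real (nat (w - z i))" "nat (w - z i) < N"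
        using w z by auto
      then show "a \<in> A N i" by (auto simp: A_def)
    qed
    then have "card (A N i) = nat (min (int N) (int N + z i) - max 0 (z i))"
      by (simp add: card_image inj_on_def)
    also have "\<dots> = nat (int N - \<bar>z i\<bar>)" by (auto simp: min_def max_def)
    finally show ?thesis .
  qed
  have "(\<lambda>N. real (card (A N i)) / real N) \<longlonglongrightarrow> 1" for i
  proof (rule Lim_transform_eventually)
    show "(\<lambda>N. (real N - real_of_int \<bar>z i\<bar>) / real N) \<longlonglongrightarrow> 1" by real_asymp
    show "\<forall>\<^sub>F N in sequentially. (real N - real_of_int \<bar>z i\<bar>) / real N = real (card (A N i)) / real N"
      using eventually_ge_at_top[of "nat \<bar>z i\<bar>"] by eventually_elim (simp add: cA)
  qed
  then have "(\<lambda>N. \<Prod>i\<in>(UNIV::'n set). real (card (A N i)) / real N) \<longlonglongrightarrow> (\<Prod>i\<in>(UNIV::'n set). 1)"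
    by (intro tendsto_prod)
  then show ?thesis by (simp add: dc card_lattice_box prod_dividef)
qed

lemma fejer_grouping:
  fixes h :: "real^'n \<Rightarrow> complex"
  assumes "(\<lambda>(j, l). j - l) ` (lattice_box N \<times> lattice_box N) \<subseteq> D" "finite D"
  shows "(\<Sum>j\<in>lattice_box N. \<Sum>l\<in>lattice_box N. h (j - l)) = (\<Sum>k\<in>D. of_nat (diff_count N k) * h k)"
proof -
  have "(\<Sum>j\<in>lattice_box N. \<Sum>l\<in>lattice_box N. h (j - l)) =
      (\<Sum>jl\<in>lattice_box N \<times> lattice_box N. h (fst jl - snd jl))"
    by (simp add: sum.cartesian_product case_prod_beta)
  also have "\<dots> = (\<Sum>k\<in>D. \<Sum>jl | jl \<in> lattice_box N \<times> lattice_box N \<and> fst jl - snd jl = k. h (fst jl - snd jl))"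
    using assms by (intro sum.group[symmetric]) (auto simp: finite_lattice_box)
  also have "\<dots> = (\<Sum>k\<in>D. of_nat (diff_count N k) * h k)"
    unfolding diff_count_def by (intro sum.cong refl) simp
  finally show ?thesis .
qed

text \<open>The double sum is the convolution of \<open>f\<close> with the squared modulus of the
  character sum over \<open>B\<close>, a nonnegative kernel.\<close>

lemma fejer_nonneg:
  fixes f :: "real^'n \<Rightarrow> real"
  assumes f: "continuous_on torus_cube f" and pos: "\<And>x. x \<in> torus_cube \<Longrightarrow> 0 \<le> f x" and B: "finite B"
  shows "0 \<le> Re (\<Sum>j\<in>B. \<Sum>l\<in>B. fourier_coeff f (j - l) * char (j - l) x)"
proof -
  have "(\<Sum>j\<in>B. \<Sum>l\<in>B. fourier_coeff f (j - l) * char (j - l) x) =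
     (\<Sum>j\<in>B. \<Sum>l\<in>B. integral torus_cube (\<lambda>y. complex_of_real (f y) * (char j (x - y) * cnj (char l (x - y)))))"
  proof (intro sum.cong refl)
    fix j l
    have "fourier_coeff f (j - l) * char (j - l) x =
        integral torus_cube (\<lambda>y. complex_of_real (f y) * char (- (j - l)) y * char (j - l) x)"
      by (simp add: fourier_coeff_char)
    also have "\<dots> = integral torus_cube (\<lambda>y. complex_of_real (f y) * (char j (x - y) * cnj (char l (x - y))))"
      by (intro integral_cong) (simp add: cis_cnj mult.assoc cis_mult cis_divide inner_diff_left inner_diff_right algebra_simps)
    finally show "fourier_coeff f (j - l) * char (j - l) x = \<dots>" .
  qed
  also have "\<dots> = (\<Sum>j\<in>B. integral torus_cube (\<lambda>y. \<Sum>l\<in>B. complex_of_real (f y) * (char j (x - y) * cnj (char l (x - y)))))"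
    by (intro sum.cong refl integral_sum[symmetric] B torus_integrable continuous_intros f)
  also have "\<dots> = integral torus_cube (\<lambda>y. \<Sum>j\<in>B. \<Sum>l\<in>B. complex_of_real (f y) * (char j (x - y) * cnj (char l (x - y))))"
    by (intro integral_sum[symmetric] B torus_integrable continuous_intros f)
  also have "\<dots> = integral torus_cube (\<lambda>y. complex_of_real (f y * (norm (\<Sum>j\<in>B. char j (x - y)))\<^sup>2))"
    by (intro integral_cong, unfold of_real_mult complex_norm_square cnj_sum sum_product)
       (simp add: sum_distrib_left)
  also have "\<dots> = complex_of_real (integral torus_cube (\<lambda>y. f y * (norm (\<Sum>j\<in>B. char j (x - y)))\<^sup>2))"
    by (intro torus_integral_complex_of_real continuous_intros f)
  also have "Re \<dots> \<ge> 0"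
    unfolding Re_complex_of_real
    by (intro integral_nonneg torus_integrable continuous_intros f mult_nonneg_nonneg pos) auto
  finally show ?thesis .
qed

text \<open>\<open>pos_mult\<close> speaks of trigonometric polynomials only. The Fejer means of
  \<open>f\<close> are nonnegative ones, so the multiplier keeps them nonnegative; their weights are
  at most 1 and tend to 1, and the summable symbol times a bound for \<open>f\<close> dominates the
  passage to the limit.\<close>

lemma fourier_mult_nonneg:
  fixes f :: "real^'n \<Rightarrow> real"
  assumes m: "msummable TYPE('n) m" "pos_mult (\<lambda>k::real^'n. m (norm k))"
    and f: "continuous_on torus_cube f" and pos: "\<And>x. x \<in> torus_cube \<Longrightarrow> 0 \<le> f x"
  shows "0 \<le> fourier_mult m f x"
proof -
  let ?L = "int_lattice :: (real^'n) set"
  define F where "F = fourier_coeff f"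
  define c where "c = (\<lambda>N (k::real^'n). complex_of_real (real (diff_count N k) / real (card (lattice_box N :: (real^'n) set))))"
  define D where "D = (\<lambda>N. (\<lambda>(j, l). j - l) ` (lattice_box N \<times> lattice_box N) :: (real^'n) set)"
  have D: "finite (D N)" "D N \<subseteq> ?L" for N
    using lattice_box_subset by (auto simp: D_def finite_lattice_box intro!: int_lattice_diff)
  have c0: "c N k = 0" if "k \<notin> D N" for N k
  proof -
    have "{jl \<in> lattice_box N \<times> lattice_box N. fst jl - snd jl = k} = {}"
      using that by (force simp: D_def)
    then show ?thesis unfolding c_def diff_count_def by (simp only: card.empty) simp
  qed
  obtain B where B: "\<And>x. x \<in> torus_cube \<Longrightarrow> \<bar>f x\<bar> \<le> B" using torus_bounded[OF f] by blast
  have FB: "norm (F k) \<le> B" for k unfolding F_def by (rule fourier_coeff_bound[OF f B])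
  have nn: "0 \<le> Re (\<Sum>\<^sub>\<infinity>k\<in>?L. complex_of_real (m (norm k)) * (c N k * F k) * char k x)" for N
  proof -
    have "0 \<le> Re (\<Sum>k\<in>D N. complex_of_real (m (norm k)) * (c N k * F k) * char k x)"
    proof (rule pos_multD[OF m(2) D(1)])
      fix y
      have "(\<Sum>j\<in>lattice_box N. \<Sum>l\<in>lattice_box N. F (j - l) * char (j - l) y) =
          (\<Sum>k\<in>D N. of_nat (diff_count N k) * (F k * char k y))"
        by (rule fejer_grouping[OF _ D(1)]) (simp add: D_def)
      then have "(\<Sum>k\<in>D N. c N k * F k * char k y) =
         (\<Sum>j\<in>lattice_box N. \<Sum>l\<in>lattice_box N. F (j - l) * char (j - l) y)
           / complex_of_real (real (card (lattice_box N :: (real^'n) set)))"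
        by (simp add: c_def sum_divide_distrib mult.assoc)
      also have "Re \<dots> \<ge> 0"
        unfolding Re_divide_of_real F_def
        by (intro divide_nonneg_nonneg fejer_nonneg f pos finite_lattice_box) auto
      finally show "0 \<le> Re (\<Sum>k\<in>D N. c N k * F k * char k y)" .
    qed
    also have "(\<Sum>k\<in>D N. complex_of_real (m (norm k)) * (c N k * F k) * char k x) =
        (\<Sum>\<^sub>\<infinity>k\<in>?L. complex_of_real (m (norm k)) * (c N k * F k) * char k x)"
      unfolding infsum_finite[OF D(1), symmetric]
      by (rule infsum_cong_neutral) (use c0 D(2) in auto)
    finally show ?thesis .
  qed
  have "(\<lambda>N. \<Sum>\<^sub>\<infinity>k\<in>?L. complex_of_real (m (norm k)) * (c N k * F k) * char k x) \<longlonglongrightarrow>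
     (\<Sum>\<^sub>\<infinity>k\<in>?L. complex_of_real (m (norm k)) * (complex_of_real 1 * F k) * char k x)"
  proof (rule infsum_tendsto_dominated)
    show "(\<lambda>k. \<bar>m (norm k)\<bar> * B) summable_on ?L"
      using m(1) by (intro summable_on_cmult_left) (simp add: msummable_def)
    show "(\<lambda>N. complex_of_real (m (norm k)) * (c N k * F k) * char k x) \<longlonglongrightarrow>
        complex_of_real (m (norm k)) * (complex_of_real 1 * F k) * char k x" if "k \<in> ?L" for k
      unfolding c_def by (intro tendsto_intros diff_count_tendsto that)
    have "norm (c N k) \<le> 1" for N k
      using diff_count_le[of N k] by (auto simp: c_def norm_divide divide_le_eq_1)
    then have "norm (complex_of_real (m (norm k)) * (c N k * F k) * char k x) \<le> \<bar>m (norm k)\<bar> * B" for N k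
      using FB[of k] mult_mono[of "norm (c N k)" 1 "norm (F k)" B]
      by (auto simp: norm_mult intro!: mult_left_mono)
    then show "\<forall>\<^sub>F N in sequentially. \<forall>k\<in>?L. norm (complex_of_real (m (norm k)) * (c N k * F k) * char k x) \<le> \<bar>m (norm k)\<bar> * B"
      by simp
  qed
  from tendsto_lowerbound[OF tendsto_Re[OF this]] nn
  have "0 \<le> Re (\<Sum>\<^sub>\<infinity>k\<in>?L. complex_of_real (m (norm k)) * (complex_of_real 1 * F k) * char k x)"
    by simp
  then show ?thesis by (simp add: fourier_mult_def F_def)
qed

section \<open>Scalar inequalities\<close>

text \<open>The odd extension of the power function. \<open>p * spow (p - 1)\<close> is the
  derivative of the \<open>p\<close>-th power of the modulus for \<open>p > 1\<close>, and
  \<open>spow (p / 2)\<close> is its signed square root.\<close>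

definition spow :: "real \<Rightarrow> real \<Rightarrow> real" where
  "spow q x = sgn x * \<bar>x\<bar> powr q"

lemma spow_conv: "spow (q - 1) x = \<bar>x\<bar> powr (q - 2) * x"
proof (cases "x = 0")
  case False
  then have "\<bar>x\<bar> powr (q - 1) = \<bar>x\<bar> powr (q - 2) * \<bar>x\<bar>"
    using powr_add[of "\<bar>x\<bar>" "q - 2" 1] by simp
  then show ?thesis by (simp add: spow_def sgn_mult_abs mult.left_commute[of "sgn x"])
qed (simp add: spow_def)

lemma spow_mult_self: "0 < q \<Longrightarrow> spow (q - 1) x * x = \<bar>x\<bar> powr q"
  using powr_add[of "\<bar>x\<bar>" "q - 1" 1] by (cases "x = 0") (auto simp: spow_def sgn_if)

lemma continuous_on_spow [continuous_intros]:
  assumes q: "0 < q" and f: "continuous_on A f"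
  shows "continuous_on A (\<lambda>x. spow q (f x))"
proof -
  \<comment> \<open>The sign function jumps at 0; splitting into positive and negative parts leaves
    continuous pieces.\<close>
  have "spow q = (\<lambda>y. max y 0 powr q - max (- y) 0 powr q)"
    using q by (auto simp: fun_eq_iff spow_def sgn_if max_def)
  moreover have "continuous_on A (\<lambda>x. max (f x) 0 powr q - max (- f x) 0 powr q)"
    using q by (intro continuous_intros continuous_on_powr' f) auto
  ultimately show ?thesis by simp
qed

lemma weighted_am_gm:
  fixes \<theta> :: real
  assumes "0 < \<theta>" "\<theta> < 1" "0 \<le> x" "0 \<le> y"
  shows "x powr \<theta> * y powr (1 - \<theta>) \<le> \<theta> * x + (1 - \<theta>) * y"
proof (cases "x = 0 \<or> y = 0")
  case False
  then show ?thesis using assms by (intro Youngs_inequality_0) auto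
qed (use assms in auto)

text \<open>After subtraction of \<open>\<theta> * (u - v)^2\<close> the quadratic terms become
  \<open>2 * \<theta> * (u * v) + (1 - 2 * \<theta>) * v^2\<close>. The claim is then the weighted
  AM-GM inequality for \<open>u * v\<close> and \<open>v^2\<close>, whose weight
  \<open>2 * \<theta>\<close> is admissible because \<open>\<theta> \<le> 1/2\<close>.\<close>

lemma refined_young_half:
  fixes \<theta> :: real
  assumes \<theta>: "0 < \<theta>" "\<theta> \<le> 1/2" and uv: "0 \<le> u" "0 \<le> v"
  shows "\<theta> * (u - v)\<^sup>2 \<le> \<theta> * u\<^sup>2 + (1 - \<theta>) * v\<^sup>2 - u powr (2 * \<theta>) * v powr (2 * (1 - \<theta>))"
proof -
  have "u powr (2 * \<theta>) * v powr (2 * (1 - \<theta>)) \<le> 2 * \<theta> * (u * v) + (1 - 2 * \<theta>) * v\<^sup>2"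
  proof (cases "u = 0 \<or> v = 0 \<or> \<theta> = 1/2")
    case False
    then have pos: "u > 0" "v > 0" "\<theta> < 1/2" using assms by auto
    have "(u * v) powr (2 * \<theta>) * (v\<^sup>2) powr (1 - 2 * \<theta>) \<le> 2 * \<theta> * (u * v) + (1 - 2 * \<theta>) * v\<^sup>2"
      using pos \<theta> by (intro weighted_am_gm) auto
    moreover have "(u * v) powr (2 * \<theta>) * (v\<^sup>2) powr (1 - 2 * \<theta>) = u powr (2 * \<theta>) * v powr (2 * (1 - \<theta>))"
    proof -
      have "(v\<^sup>2) powr (1 - 2 * \<theta>) = v powr (2 - 4 * \<theta>)"
        using pos by (simp add: powr_powr algebra_simps flip: powr_numeral)
      then have "(u * v) powr (2 * \<theta>) * (v\<^sup>2) powr (1 - 2 * \<theta>) = u powr (2 * \<theta>) * (v powr (2 * \<theta>) * v powr (2 - 4 * \<theta>))"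
        using pos by (simp add: powr_mult)
      also have "v powr (2 * \<theta>) * v powr (2 - 4 * \<theta>) = v powr (2 * (1 - \<theta>))"
        by (simp add: algebra_simps flip: powr_add)
      finally show ?thesis .
    qed
    ultimately show ?thesis by simp
  next
    case True
    then show ?thesis
    proof (cases "\<theta> = 1/2")
      case True
      show ?thesis unfolding True using uv by simp
    qed (use \<theta> uv in auto)
  qed
  then show ?thesis by (simp add: power2_eq_square algebra_simps)
qed

lemma refined_young:
  fixes \<theta> :: real
  assumes \<theta>: "0 < \<theta>" "\<theta> < 1" and uv: "0 \<le> u" "0 \<le> v"
  shows "min \<theta> (1 - \<theta>) * (u - v)\<^sup>2 \<le> \<theta> * u\<^sup>2 + (1 - \<theta>) * v\<^sup>2 - u powr (2 * \<theta>) * v powr (2 * (1 - \<theta>))"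
proof (cases "\<theta> \<le> 1/2")
  case True
  then show ?thesis using refined_young_half[of \<theta> u v] assms by (simp add: min_def)
next
  case False
  then have "min \<theta> (1 - \<theta>) = 1 - \<theta>" by simp
  then show ?thesis using refined_young_half[of "1 - \<theta>" v u] False assms
    by (simp add: mult.commute power2_commute algebra_simps)
qed

text \<open>In the variables \<open>u = |b| powr (p/2)\<close>, \<open>v = |a| powr (p/2)\<close> the Bregman divergence of
  \<open>|.| powr p\<close> is \<open>p\<close> times the defect in Young's inequality with weight \<open>1/p\<close>, up to signs.\<close>

lemma bregman_powr_lower:
  fixes p :: real
  assumes p: "1 < p"
  shows "min 1 (p - 1) / 2 * (spow (p/2) b - spow (p/2) a)\<^sup>2 \<le>
    \<bar>b\<bar> powr p - \<bar>a\<bar> powr p - p * spow (p - 1) a * (b - a)"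
proof -
  define \<theta> u v where "\<theta> = 1 / p" and "u = \<bar>b\<bar> powr (p/2)" and "v = \<bar>a\<bar> powr (p/2)"
  have \<theta>: "0 < \<theta>" "\<theta> < 1" using p by (auto simp: \<theta>_def)
  have uv: "0 \<le> u" "0 \<le> v" by (auto simp: u_def v_def)
  have u2: "\<bar>b\<bar> powr p = u\<^sup>2" and v2: "\<bar>a\<bar> powr p = v\<^sup>2"
    by (simp_all add: u_def v_def power2_eq_square flip: powr_add)
  have mix: "u powr (2 * \<theta>) * v powr (2 * (1 - \<theta>)) = \<bar>b\<bar> * \<bar>a\<bar> powr (p - 1)"
  proof -
    have e: "p / 2 * (2 * \<theta>) = 1" "p / 2 * (2 * (1 - \<theta>)) = p - 1"
      using p by (auto simp: \<theta>_def field_simps)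
    show ?thesis unfolding u_def v_def powr_powr e by simp
  qed
  have kap: "p * min \<theta> (1 - \<theta>) = min 1 (p - 1)"
    using p by (auto simp: min_def \<theta>_def field_simps)
  have expand: "\<bar>b\<bar> powr p - \<bar>a\<bar> powr p - p * spow (p - 1) a * (b - a) =
      p * (\<theta> * u\<^sup>2 + (1 - \<theta>) * v\<^sup>2 - sgn a * sgn b * (u powr (2 * \<theta>) * v powr (2 * (1 - \<theta>))))"
  proof -
    have "p * spow (p - 1) a * (b - a) = p * (sgn a * sgn b * (\<bar>b\<bar> * \<bar>a\<bar> powr (p - 1))) - p * \<bar>a\<bar> powr p"
      using spow_mult_self[of p a] p by (simp add: spow_def sgn_if algebra_simps)
    moreover have "p * (\<theta> * u\<^sup>2) = u\<^sup>2" "p * ((1 - \<theta>) * v\<^sup>2) = p * v\<^sup>2 - v\<^sup>2" using p by (auto simp: \<theta>_def field_simps)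
    moreover have dist: "p * (\<theta> * u\<^sup>2 + (1 - \<theta>) * v\<^sup>2 - S) = p * (\<theta> * u\<^sup>2) + p * ((1 - \<theta>) * v\<^sup>2) - p * S" for S
      by (simp only: right_diff_distrib distrib_left)
    ultimately show ?thesis unfolding mix u2 v2 dist by (simp only:)
  qed
  have RY: "min \<theta> (1 - \<theta>) * (u - v)\<^sup>2 \<le> \<theta> * u\<^sup>2 + (1 - \<theta>) * v\<^sup>2 - u powr (2 * \<theta>) * v powr (2 * (1 - \<theta>))"
    by (rule refined_young[OF \<theta> uv])
  have G: "spow (p/2) b = sgn b * u" "spow (p/2) a = sgn a * v" by (simp_all add: spow_def u_def v_def)
  have "min \<theta> (1 - \<theta>) / 2 * (sgn b * u - sgn a * v)\<^sup>2 \<le>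
      \<theta> * u\<^sup>2 + (1 - \<theta>) * v\<^sup>2 - sgn a * sgn b * (u powr (2 * \<theta>) * v powr (2 * (1 - \<theta>)))"
  proof (cases "sgn a * sgn b = 1")
    case True
    then have "(sgn b * u - sgn a * v)\<^sup>2 = (u - v)\<^sup>2"
      by (auto simp: sgn_if power2_commute split: if_splits)
    moreover have "min \<theta> (1 - \<theta>) / 2 * (u - v)\<^sup>2 \<le> min \<theta> (1 - \<theta>) * (u - v)\<^sup>2"
      using \<theta> by (intro mult_right_mono) auto
    ultimately show ?thesis using RY True by simp
  next
    case False
    \<comment> \<open>If the signs differ or one of them is 0, the mixed term only helps. However,
      the square on the left can reach \<open>2 * (u^2 + v^2)\<close>, which is the origin of the
      factor 1/2 in the constant.\<close>
    have "(sgn b * u - sgn a * v)\<^sup>2 \<le> 2 * (u\<^sup>2 + v\<^sup>2)"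
    proof -
      have "(sgn b * u - sgn a * v)\<^sup>2 \<le> 2 * ((sgn b * u)\<^sup>2 + (sgn a * v)\<^sup>2)"
        using zero_le_power2[of "sgn b * u + sgn a * v"] by (simp add: power2_eq_square algebra_simps)
      also have "\<dots> \<le> 2 * (u\<^sup>2 + v\<^sup>2)" by (auto simp: sgn_if)
      finally show ?thesis .
    qed
    then have "min \<theta> (1 - \<theta>) / 2 * (sgn b * u - sgn a * v)\<^sup>2 \<le> min \<theta> (1 - \<theta>) / 2 * (2 * (u\<^sup>2 + v\<^sup>2))"
      using \<theta> by (intro mult_left_mono) auto
    also have "\<dots> = min \<theta> (1 - \<theta>) * u\<^sup>2 + min \<theta> (1 - \<theta>) * v\<^sup>2" by (simp add: algebra_simps)
    also have "\<dots> \<le> \<theta> * u\<^sup>2 + (1 - \<theta>) * v\<^sup>2"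
      by (intro add_mono mult_right_mono) auto
    also have "\<dots> \<le> \<theta> * u\<^sup>2 + (1 - \<theta>) * v\<^sup>2 - sgn a * sgn b * (u powr (2 * \<theta>) * v powr (2 * (1 - \<theta>)))"
      using False by (auto simp: sgn_if split: if_splits)
    finally show ?thesis .
  qed
  then have "p * (min \<theta> (1 - \<theta>) / 2 * (sgn b * u - sgn a * v)\<^sup>2) \<le>
     \<bar>b\<bar> powr p - \<bar>a\<bar> powr p - p * spow (p - 1) a * (b - a)"
    unfolding expand using p by (intro mult_left_mono) auto
  moreover have "p * (min \<theta> (1 - \<theta>) / 2 * (sgn b * u - sgn a * v)\<^sup>2) = min 1 (p - 1) / 2 * (sgn b * u - sgn a * v)\<^sup>2"
    unfolding kap[symmetric] by simp
  ultimately show ?thesis unfolding G by (simp only:)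
qed

text \<open>The product expands to \<open>u^2 + v^2\<close> minus a signed mixed term
  \<open>X\<close>. For equal signs \<open>X \<ge> 2 * u * v\<close> gives the bound even without
  the factor 2. For opposite signs \<open>X \<le> u^2 + v^2\<close>, and the factor 2 absorbs
  it.\<close>

lemma monotone_powr_upper:
  fixes p :: real
  assumes p: "1 < p"
  shows "(a - b) * (spow (p - 1) a - spow (p - 1) b) \<le> 2 * (spow (p/2) a - spow (p/2) b)\<^sup>2"
proof -
  define \<theta> u v where "\<theta> = 1 / p" and "u = \<bar>a\<bar> powr (p/2)" and "v = \<bar>b\<bar> powr (p/2)"
  have \<theta>: "0 < \<theta>" "\<theta> < 1" using p by (auto simp: \<theta>_def)
  have u2: "\<bar>a\<bar> powr p = u\<^sup>2" and v2: "\<bar>b\<bar> powr p = v\<^sup>2"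
    by (simp_all add: u_def v_def power2_eq_square flip: powr_add)
  define X where "X = \<bar>a\<bar> * \<bar>b\<bar> powr (p - 1) + \<bar>b\<bar> * \<bar>a\<bar> powr (p - 1)"
  have X0: "0 \<le> X" by (simp add: X_def)
  have G: "spow (p/2) a = sgn a * u" "spow (p/2) b = sgn b * v" by (simp_all add: spow_def u_def v_def)
  have expand: "(a - b) * (spow (p - 1) a - spow (p - 1) b) = u\<^sup>2 + v\<^sup>2 - sgn a * sgn b * X"
    using spow_mult_self[of p a] spow_mult_self[of p b] p
    by (simp add: spow_def sgn_if algebra_simps u2 v2 X_def)
  have am: "2 * (u * v) \<le> X"
  proof -
    define y z where "y = \<bar>a\<bar> * \<bar>b\<bar> powr (p - 1)" and "z = \<bar>b\<bar> * \<bar>a\<bar> powr (p - 1)"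
    have "(u * v)\<^sup>2 = y * z"
    proof -
      have "\<bar>a\<bar> powr p = \<bar>a\<bar> * \<bar>a\<bar> powr (p - 1)" "\<bar>b\<bar> powr p = \<bar>b\<bar> * \<bar>b\<bar> powr (p - 1)"
        using powr_add[of "\<bar>a\<bar>" 1 "p - 1"] powr_add[of "\<bar>b\<bar>" 1 "p - 1"] by auto
      then show ?thesis by (simp add: power_mult_distrib y_def z_def flip: u2 v2)
    qed
    then have "u * v = sqrt (y * z)" by (metis real_sqrt_unique mult_nonneg_nonneg powr_ge_zero u_def v_def)
    also have "\<dots> \<le> (y + z) / 2" by (intro arith_geo_mean_sqrt) (auto simp: y_def z_def)
    finally show ?thesis by (simp add: X_def y_def z_def)
  qed
  have X2: "X \<le> u\<^sup>2 + v\<^sup>2"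
  proof -
    have m: "\<bar>x\<bar> * \<bar>y\<bar> powr (p - 1) \<le> \<theta> * \<bar>x\<bar> powr p + (1 - \<theta>) * \<bar>y\<bar> powr p" for x y
    proof -
      have "(\<bar>x\<bar> powr p) powr \<theta> * (\<bar>y\<bar> powr p) powr (1 - \<theta>) \<le> \<theta> * \<bar>x\<bar> powr p + (1 - \<theta>) * \<bar>y\<bar> powr p"
        using \<theta> by (intro weighted_am_gm) auto
      moreover have "p * (1 - \<theta>) = p - 1" "p * \<theta> = 1" using p by (auto simp: \<theta>_def field_simps)
      ultimately show ?thesis by (simp add: powr_powr split: if_splits)
    qed
    show ?thesis using m[of a b] m[of b a] unfolding X_def u2 v2 by (simp add: algebra_simps)
  qed
  consider "sgn a * sgn b = 1" | "sgn a * sgn b = 0" | "sgn a * sgn b = -1"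
    by (cases a "0::real" rule: linorder_cases; cases b "0::real" rule: linorder_cases) auto
  then show ?thesis
  proof cases
    case 1
    then have "(sgn a * u - sgn b * v)\<^sup>2 = u\<^sup>2 + v\<^sup>2 - 2 * (u * v)"
      by (auto simp: sgn_if power2_eq_square algebra_simps split: if_splits)
    moreover have "0 \<le> (sgn a * u - sgn b * v)\<^sup>2" by simp
    ultimately show ?thesis unfolding expand G 1 using am by linarith
  next
    case 2
    then have "(sgn a * u - sgn b * v)\<^sup>2 = u\<^sup>2 + v\<^sup>2"
      using p by (auto simp: sgn_if u_def v_def split: if_splits)
    then show ?thesis unfolding expand G 2 by simp
  next
    case 3
    then have "(sgn a * u - sgn b * v)\<^sup>2 = u\<^sup>2 + v\<^sup>2 + 2 * (u * v)"
      by (auto simp: sgn_if power2_eq_square algebra_simps split: if_splits)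
    moreover have "0 \<le> u * v" by (simp add: u_def v_def)
    ultimately show ?thesis unfolding expand G 3 using X2 by linarith
  qed
qed

section \<open>Exponential decay of the energy\<close>

lemma frac_semigroup_props:
  fixes s t :: real
  assumes "0 < s" "s \<le> 2" "0 < t"
  shows "msummable TYPE('n::finite) (\<lambda>r. exp (- t * r powr s))"
    and "pos_mult (\<lambda>k::real^'n. exp (- t * norm k powr s))"
  using summable_on_lattice_exp_powr[of s t, where 'n='n] pos_mult_stable[of s t] assms
  by (auto simp: msummable_def)

text \<open>Parseval for the image of \<open>g\<close>, which has an absolutely convergent series
  even when \<open>g\<close> is merely continuous: pair that series with the image itself and
  integrate termwise.\<close>

lemma integral_square_fourier_mult:
  fixes g :: "real^'n \<Rightarrow> real"
  assumes m: "msummable TYPE('n) m" and g: "continuous_on torus_cube g"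
  shows "((\<lambda>k. (m (norm k))\<^sup>2 * (norm (fourier_coeff g k))\<^sup>2) has_sum
    integral torus_cube (\<lambda>x. (fourier_mult m g x)\<^sup>2)) int_lattice"
proof -
  define u where "u = fourier_mult m g"
  define a where "a = (\<lambda>k. complex_of_real (m (norm k)) * fourier_coeff g k)"
  have a: "fsummable a" unfolding a_def by (rule fsummable_mult_coeff[OF m g])
  have u: "continuous_on torus_cube u" unfolding u_def by (rule continuous_on_fourier_mult[OF m g])
  have Re_u: "Re (fseries a x) = u x" for x by (simp add: u_def a_def fourier_mult_fseries)
  define w where "w = (\<lambda>k::real^'n. (m (norm k))\<^sup>2 * (norm (fourier_coeff g k))\<^sup>2)"
  have cu: "continuous_on torus_cube (\<lambda>x. complex_of_real (u x))" by (intro continuous_intros u)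
  have "integral torus_cube (\<lambda>x. fseries a x * complex_of_real (u x)) =
      (\<Sum>\<^sub>\<infinity>k\<in>int_lattice. a k * integral torus_cube (\<lambda>x. complex_of_real (u x) * char k x))"
    by (rule integral_fseries_mult[OF a cu])
  also have "\<dots> = (\<Sum>\<^sub>\<infinity>k\<in>int_lattice. complex_of_real (w k))"
  proof (rule infsum_cong)
    fix k :: "real^'n" assume k: "k \<in> int_lattice"
    have "integral torus_cube (\<lambda>x. complex_of_real (u x) * char k x) = fourier_coeff u (- k)"
      by (simp add: fourier_coeff_char)
    also have "\<dots> = complex_of_real (m (norm k)) * cnj (fourier_coeff g k)"
      unfolding u_def using fourier_coeff_fourier_mult[OF m g int_lattice_uminus[OF k]]
      by (simp add: fourier_coeff_cnj[OF g])
    finally show "a k * integral torus_cube (\<lambda>x. complex_of_real (u x) * char k x) = complex_of_real (w k)"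
      unfolding w_def a_def of_real_mult complex_norm_square by (simp add: power2_eq_square)
  qed
  finally have "Re (integral torus_cube (\<lambda>x. fseries a x * complex_of_real (u x))) =
      Re (\<Sum>\<^sub>\<infinity>k\<in>int_lattice. complex_of_real (w k))" by simp
  moreover have "Re (integral torus_cube (\<lambda>x. fseries a x * complex_of_real (u x))) =
      integral torus_cube (\<lambda>x. (u x)\<^sup>2)"
  proof -
    have "Re (integral torus_cube (\<lambda>x. fseries a x * complex_of_real (u x))) =
        integral torus_cube (\<lambda>x. Re (fseries a x * complex_of_real (u x)))"
      using integral_linear[OF torus_integrable bounded_linear_Re, OF continuous_on_mult[OF continuous_on_fseries[OF a] cu]]
      by (simp add: o_def)
    then show ?thesis by (simp add: Re_u power2_eq_square)
  qed
  \<comment> \<open>A divergent unordered sum has the default value 0, so \<open>has_sum\<close>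
    requires summability separately. An absolutely summable family is bounded by its total, hence
    square-summable.\<close>
  moreover have ws: "w summable_on int_lattice"
  proof -
    obtain B where B: "\<And>x. x \<in> torus_cube \<Longrightarrow> \<bar>g x\<bar> \<le> B" using torus_bounded[OF g] by blast
    have FB: "norm (fourier_coeff g k) \<le> B" for k by (rule fourier_coeff_bound[OF g B])
    define M where "M = (\<Sum>\<^sub>\<infinity>k\<in>int_lattice. norm (a k))"
    have aM: "norm (a k) \<le> M" if "k \<in> int_lattice" for k
      using finite_sum_le_infsum[of "\<lambda>k. norm (a k)" int_lattice "{k}"] a that
      by (auto simp: M_def fsummable_def)
    show ?thesis
    proof (rule summable_on_comparison_test)
      show "(\<lambda>k. M * norm (a k)) summable_on int_lattice"
        using a by (intro summable_on_cmult_right) (simp add: fsummable_def)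
      fix k :: "real^'n" assume "k \<in> int_lattice"
      then have "norm (a k) * norm (a k) \<le> M * norm (a k)" by (intro mult_right_mono aM) auto
      then show "w k \<le> M * norm (a k)"
        by (simp add: w_def a_def norm_mult power2_eq_square abs_mult mult_ac)
    qed (simp add: w_def)
  qed
  moreover have "((\<lambda>k. complex_of_real (w k)) has_sum complex_of_real (infsum w int_lattice)) int_lattice"
    by (rule has_sum_of_real[OF has_sum_infsum[OF ws]])
  then have "(\<Sum>\<^sub>\<infinity>k\<in>int_lattice. complex_of_real (w k)) = complex_of_real (infsum w int_lattice)"
    by (rule infsumI)
  ultimately show ?thesis
    unfolding w_def[symmetric] u_def[symmetric] by (simp add: has_sum_iff)
qed

text \<open>Nonzero frequencies have length at least 1, so their squared factors are at most
  \<open>exp (- 2 * t)\<close> for every \<open>s\<close>, while the mean is kept. Bessel's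
  inequality bounds the total over the nonzero frequencies.\<close>

lemma frac_semigroup_L2_contraction:
  fixes g :: "real^'n \<Rightarrow> real"
  assumes st: "0 < s" "s \<le> 2" "0 < t" and g: "continuous_on torus_cube g"
  shows "integral torus_cube (\<lambda>x. (frac_semigroup s t g x)\<^sup>2) \<le> (integral torus_cube g)\<^sup>2
    + exp (- 2 * t) * (integral torus_cube (\<lambda>x. (g x)\<^sup>2) - (integral torus_cube g)\<^sup>2)"
    (is "_ \<le> ?R")
proof -
  define m where "m = (\<lambda>r::real. exp (- t * r powr s))"
  define F where "F = (\<lambda>k. (norm (fourier_coeff g k))\<^sup>2)"
  have F0: "F 0 = (integral torus_cube g)\<^sup>2" by (simp add: F_def fourier_coeff_0[OF g])
  have le: "(m (norm k))\<^sup>2 \<le> exp (- 2 * t)" if "k \<in> int_lattice" "k \<noteq> 0" for k :: "real^'n"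
  proof -
    have "1 \<le> norm k powr s" using norm_lattice_ge_1[OF that] st by (intro ge_one_powr_ge_zero) auto
    then have "- t * norm k powr s \<le> - t" using st by simp
    then have "m (norm k) \<le> exp (- t)" by (simp add: m_def)
    then have "(m (norm k))\<^sup>2 \<le> (exp (- t))\<^sup>2" by (intro power_mono) (auto simp: m_def)
    then show ?thesis by (simp add: power2_eq_square flip: exp_add)
  qed
  have bd: "(\<Sum>k\<in>S. (m (norm k))\<^sup>2 * F k) \<le> ?R" if S: "finite S" "S \<subseteq> int_lattice" for S
  proof -
    have "(\<Sum>k\<in>S. (m (norm k))\<^sup>2 * F k) \<le> (\<Sum>k\<in>insert 0 S. (m (norm k))\<^sup>2 * F k)"
      using S by (intro sum_mono2) (auto simp: F_def)
    also have "\<dots> = F 0 + (\<Sum>k\<in>S - {0}. (m (norm k))\<^sup>2 * F k)"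
      using S by (simp add: sum.insert_remove m_def)
    also have "\<dots> \<le> F 0 + (\<Sum>k\<in>S - {0}. exp (- 2 * t) * F k)"
      using S by (intro add_left_mono sum_mono mult_right_mono le) (auto simp: F_def)
    also have "\<dots> = F 0 + exp (- 2 * t) * ((\<Sum>k\<in>insert 0 S. F k) - F 0)"
      using S by (simp add: sum.insert_remove sum_distrib_left)
    also have "\<dots> \<le> F 0 + exp (- 2 * t) * (integral torus_cube (\<lambda>x. (g x)\<^sup>2) - F 0)"
      unfolding F_def using S int_lattice_0
      by (intro add_left_mono mult_left_mono diff_right_mono Bessel_inequality g) auto
    finally show ?thesis by (simp add: F0)
  qed
  have hs: "((\<lambda>k. (m (norm k))\<^sup>2 * F k) has_sum integral torus_cube (\<lambda>x. (fourier_mult m g x)\<^sup>2)) int_lattice"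
    unfolding F_def m_def by (rule integral_square_fourier_mult[OF frac_semigroup_props(1)[OF st] g])
  show ?thesis
    unfolding frac_semigroup_def m_def[symmetric]
    by (rule has_sum_le_finite_sums[OF hs bd])
qed

definition energy :: "real \<Rightarrow> (real^'n \<Rightarrow> real) \<Rightarrow> real" where
  "energy p f = integral torus_cube (\<lambda>x. \<bar>f x\<bar> powr p)"

lemma spow_half_square: "(spow (p / 2) x)\<^sup>2 = \<bar>x\<bar> powr p"
  by (simp add: spow_def power_mult_distrib power2_eq_square sgn_if flip: powr_add)

lemma continuous_on_abs_powr [continuous_intros]:
  fixes f :: "'a::topological_space \<Rightarrow> real"
  assumes "0 < p" "continuous_on A f"
  shows "continuous_on A (\<lambda>x. \<bar>f x\<bar> powr p)"
  using assms by (intro continuous_on_powr' continuous_intros) auto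

lemma torus_has_integral:
  fixes f :: "real^'n \<Rightarrow> real"
  shows "continuous_on torus_cube f \<Longrightarrow> (f has_integral integral torus_cube f) torus_cube"
  by (simp add: integrable_integral torus_integrable)

lemma torus_has_integral_const: "((\<lambda>x::real^'n. c::real) has_integral c) torus_cube"
  using torus_has_integral[of "\<lambda>x::real^'n. c"] by (simp add: integral_torus_const)

lemma energy_decrease:
  fixes f :: "real^'n \<Rightarrow> real"
  assumes st: "0 < s" "s \<le> 2" "0 < t" and p: "1 < p" and f: "continuous_on torus_cube f"
  shows "energy p (frac_semigroup s t f) \<le> energy p f - min 1 (p - 1) / 2 * (1 - exp (- 2 * t)) *
     (energy p f - (integral torus_cube (\<lambda>x. spow (p / 2) (f x)))\<^sup>2)"
proof -
  define m where "m = (\<lambda>r::real. exp (- t * r powr s))"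
  define \<kappa> where "\<kappa> = min 1 (p - 1) / 2"
  have \<kappa>: "0 \<le> \<kappa>" "\<kappa> \<le> 1" using p by (auto simp: \<kappa>_def)
  have m: "msummable TYPE('n) m" "pos_mult (\<lambda>k::real^'n. m (norm k))"
    unfolding m_def by (rule frac_semigroup_props[OF st])+
  have m0: "m 0 = 1" by (simp add: m_def)
  define P where "P = (fourier_mult m :: (real^'n \<Rightarrow> real) \<Rightarrow> _)"
  define g where "g = (\<lambda>x. spow (p / 2) (f x))"
  define w where "w = (\<lambda>x. \<bar>f x\<bar> powr p)"
  have g: "continuous_on torus_cube g" and w: "continuous_on torus_cube w"
    unfolding g_def w_def using p by (auto intro!: continuous_intros f)
  have wg: "w x = (g x)\<^sup>2" for x by (simp add: w_def g_def spow_half_square)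
  have lin: "P (\<lambda>y. \<alpha> * u y + v y) x = \<alpha> * P u x + P v x"
    if "continuous_on torus_cube u" "continuous_on torus_cube v" for \<alpha> u v x
    unfolding P_def by (rule fourier_mult_linear[OF m(1) that])
  have cP: "continuous_on torus_cube (P u)" if "continuous_on torus_cube u" for u
    unfolding P_def by (rule continuous_on_fourier_mult[OF m(1) that])
  have point: "\<bar>P f x\<bar> powr p \<le> (1 - \<kappa>) * P w x + \<kappa> * (P g x)\<^sup>2" for x
  proof -
    \<comment> \<open>Freezing the base point at the value of \<open>P f\<close> at \<open>x\<close>
      makes the tangent term vanish after \<open>P\<close> is applied at \<open>x\<close>.\<close>
    define A where "A = P f x"
    define G where "G = spow (p / 2) A"
    define C where "C = - (\<bar>A\<bar> powr p) + p * spow (p - 1) A * A - \<kappa> * G\<^sup>2"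
    \<comment> \<open>The Bregman divergence at base \<open>A\<close> minus
      \<open>\<kappa> * (g y - G)^2\<close>, with \<open>w = g^2\<close> collected and the terms
      nested in the form \<open>\<alpha> * u + v\<close> for linearity.\<close>
    define h where "h = (\<lambda>y. (1 - \<kappa>) * w y + ((- (p * spow (p - 1) A)) * f y + (2 * \<kappa> * G * g y + C)))"
    have "0 \<le> P h x"
      unfolding P_def
    proof (rule fourier_mult_nonneg[OF m])
      show "continuous_on torus_cube h" unfolding h_def by (intro continuous_intros w f g)
      fix y :: "real^'n"
      have "\<kappa> * (g y - G)\<^sup>2 \<le> \<bar>f y\<bar> powr p - \<bar>A\<bar> powr p - p * spow (p - 1) A * (f y - A)"
        unfolding g_def G_def \<kappa>_def by (rule bregman_powr_lower[OF p])
      then show "0 \<le> h y"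
        unfolding h_def C_def wg w_def[THEN fun_cong, of y, unfolded wg, symmetric]
        by (simp add: power2_eq_square algebra_simps)
    qed
    also have "P h x = (1 - \<kappa>) * P w x + (- (p * spow (p - 1) A) * A + (2 * \<kappa> * G * P g x + C))"
    proof -
      have c1: "continuous_on torus_cube (\<lambda>y. 2 * \<kappa> * G * g y + C)" by (intro continuous_intros g)
      have c2: "continuous_on torus_cube (\<lambda>y. - (p * spow (p - 1) A) * f y + (2 * \<kappa> * G * g y + C))"
        by (intro continuous_intros g f)
      have "P (\<lambda>y. C) x = C" unfolding P_def by (rule fourier_mult_const[of m, OF m0])
      then show ?thesis
        unfolding h_def lin[OF w c2] lin[OF f c1] lin[OF g continuous_on_const] by (simp add: A_def)
    qed
    finally have "\<bar>A\<bar> powr p \<le> (1 - \<kappa>) * P w x + (2 * \<kappa> * G * P g x - \<kappa> * G\<^sup>2)"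
      by (simp add: C_def)
    \<comment> \<open>Completing the square eliminates \<open>G\<close>, which is not the image of
      \<open>g\<close> under \<open>P\<close>.\<close>
    also have "2 * \<kappa> * G * P g x - \<kappa> * G\<^sup>2 \<le> \<kappa> * (P g x)\<^sup>2"
      using mult_nonneg_nonneg[OF \<kappa>(1) zero_le_power2[of "P g x - G"]]
      by (simp add: power2_eq_square algebra_simps)
    finally show ?thesis by (simp add: A_def)
  qed
  have "energy p (P f) \<le> (1 - \<kappa>) * integral torus_cube (P w) + \<kappa> * integral torus_cube (\<lambda>x. (P g x)\<^sup>2)"
  proof (rule has_integral_le)
    show "((\<lambda>x. \<bar>P f x\<bar> powr p) has_integral energy p (P f)) torus_cube"
      unfolding energy_def using p by (intro torus_has_integral continuous_intros cP f) auto
    show "((\<lambda>x. (1 - \<kappa>) * P w x + \<kappa> * (P g x)\<^sup>2) has_integral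
        (1 - \<kappa>) * integral torus_cube (P w) + \<kappa> * integral torus_cube (\<lambda>x. (P g x)\<^sup>2)) torus_cube"
      by (intro has_integral_add has_integral_mult_right torus_has_integral continuous_intros cP w g)
  qed (rule point)
  also have "integral torus_cube (P w) = energy p f"
    unfolding P_def integral_fourier_mult[OF m(1) m0 w] by (simp add: energy_def w_def)
  also have "integral torus_cube (\<lambda>x. (P g x)\<^sup>2) \<le> (integral torus_cube g)\<^sup>2
      + exp (- 2 * t) * (energy p f - (integral torus_cube g)\<^sup>2)"
    using frac_semigroup_L2_contraction[OF st g]
    unfolding frac_semigroup_def m_def[symmetric] P_def[symmetric] wg[symmetric] by (simp add: energy_def w_def)
  then have "\<kappa> * integral torus_cube (\<lambda>x. (P g x)\<^sup>2) \<le> \<kappa> * ((integral torus_cube g)\<^sup>2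
      + exp (- 2 * t) * (energy p f - (integral torus_cube g)\<^sup>2))"
    by (intro mult_left_mono \<kappa>)
  finally have "energy p (P f) \<le> (1 - \<kappa>) * energy p f + \<kappa> * ((integral torus_cube g)\<^sup>2
      + exp (- 2 * t) * (energy p f - (integral torus_cube g)\<^sup>2))" by simp
  also have "\<dots> = energy p f - \<kappa> * (1 - exp (- 2 * t)) * (energy p f - (integral torus_cube g)\<^sup>2)"
    by (simp add: algebra_simps)
  finally show ?thesis
    unfolding P_def frac_semigroup_def m_def \<kappa>_def g_def .
qed

text \<open>Since \<open>f\<close> has mean zero, \<open>2 * energy p f\<close> is the double integral over \<open>x, y\<close> of
  \<open>(f x - f y) * (spow (p - 1) (f x) - spow (p - 1) (f y))\<close>.\<close>

lemma energy_le_variance: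
  fixes f :: "real^'n \<Rightarrow> real"
  assumes p: "1 < p" and f: "continuous_on torus_cube f" and mean: "integral torus_cube f = 0"
  shows "energy p f \<le> 2 * (energy p f - (integral torus_cube (\<lambda>x. spow (p / 2) (f x)))\<^sup>2)"
proof -
  define \<phi> g where "\<phi> = (\<lambda>x. spow (p - 1) (f x))" and "g = (\<lambda>x. spow (p / 2) (f x))"
  define N \<Phi> M where "N = energy p f" and "\<Phi> = integral torus_cube \<phi>" and "M = integral torus_cube g"
  have hf: "(f has_integral 0) torus_cube" using torus_has_integral[OF f] mean by simp
  have h\<phi>: "(\<phi> has_integral \<Phi>) torus_cube"
    unfolding \<Phi>_def \<phi>_def using p by (intro torus_has_integral continuous_intros f) auto
  have hg: "(g has_integral M) torus_cube"
    unfolding M_def g_def using p by (intro torus_has_integral continuous_intros f) auto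
  have hN: "((\<lambda>x. \<bar>f x\<bar> powr p) has_integral N) torus_cube"
    unfolding N_def energy_def using p by (intro torus_has_integral continuous_intros f) auto
  have point: "\<bar>f x\<bar> powr p + \<bar>b\<bar> powr p - spow (p - 1) b * f x - b * \<phi> x \<le>
      2 * (\<bar>f x\<bar> powr p - 2 * spow (p / 2) b * g x + \<bar>b\<bar> powr p)" for x b
  proof -
    have "\<bar>f x\<bar> powr p + \<bar>b\<bar> powr p - spow (p - 1) b * f x - b * \<phi> x = (f x - b) * (\<phi> x - spow (p - 1) b)"
      using spow_mult_self[of p "f x"] spow_mult_self[of p b] p by (simp add: \<phi>_def algebra_simps)
    also have "\<dots> \<le> 2 * (g x - spow (p / 2) b)\<^sup>2"
      unfolding \<phi>_def g_def by (rule monotone_powr_upper[OF p])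
    also have "\<dots> = 2 * ((g x)\<^sup>2 - 2 * spow (p / 2) b * g x + (spow (p / 2) b)\<^sup>2)"
      by (simp add: power2_eq_square algebra_simps)
    finally show ?thesis unfolding g_def spow_half_square .
  qed
  \<comment> \<open>Integration over \<open>x\<close> with \<open>b\<close> frozen; the double
    integral is carried out as two single ones.\<close>
  have inner: "N + \<bar>b\<bar> powr p - spow (p - 1) b * 0 - b * \<Phi> \<le>
      2 * (N - 2 * spow (p / 2) b * M + \<bar>b\<bar> powr p)" for b
  proof (rule has_integral_le)
    show "((\<lambda>x. \<bar>f x\<bar> powr p + \<bar>b\<bar> powr p - spow (p - 1) b * f x - b * \<phi> x) has_integral
        (N + \<bar>b\<bar> powr p - spow (p - 1) b * 0 - b * \<Phi>)) torus_cube"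
      by (intro has_integral_add has_integral_diff has_integral_mult_right torus_has_integral_const hf h\<phi> hN)
    show "((\<lambda>x. 2 * (\<bar>f x\<bar> powr p - 2 * spow (p / 2) b * g x + \<bar>b\<bar> powr p)) has_integral
        2 * (N - 2 * spow (p / 2) b * M + \<bar>b\<bar> powr p)) torus_cube"
      by (intro has_integral_add has_integral_diff has_integral_mult_right torus_has_integral_const hg hN)
  qed (rule point)
  \<comment> \<open>Second integration, at \<open>b = f y\<close>. Both mixed terms have vanished by
    the zero mean, and \<open>2 * N \<le> 4 * N - 4 * M^2\<close> is twice the claim.\<close>
  have "N + N - 0 * \<Phi> \<le> 2 * (N - 2 * M * M + N)"
  proof (rule has_integral_le)
    show "((\<lambda>y. N + \<bar>f y\<bar> powr p - f y * \<Phi>) has_integral (N + N - 0 * \<Phi>)) torus_cube"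
      by (intro has_integral_add has_integral_diff has_integral_mult_left torus_has_integral_const hf hN)
    show "((\<lambda>y. 2 * (N - 2 * M * g y + \<bar>f y\<bar> powr p)) has_integral 2 * (N - 2 * M * M + N)) torus_cube"
      by (intro has_integral_add has_integral_diff has_integral_mult_right torus_has_integral_const hg hN)
    show "N + \<bar>f y\<bar> powr p - f y * \<Phi> \<le> 2 * (N - 2 * M * g y + \<bar>f y\<bar> powr p)" for y
      using inner[of "f y"] by (simp add: g_def mult_ac)
  qed
  then show ?thesis
    unfolding N_def[symmetric] M_def[unfolded g_def, symmetric] by (simp add: power2_eq_square)
qed

lemma energy_nonneg: "0 \<le> energy p f"
proof (cases "(\<lambda>x. \<bar>f x\<bar> powr p) integrable_on torus_cube")
  case True then show ?thesis unfolding energy_def by (rule integral_nonneg) auto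
qed (simp add: energy_def not_integrable_integral)

text \<open>The 8 collects three factors 2: from the Bregman constant, from
  \<open>1 - exp (- 2 * t) \<ge> t / 2\<close>, and from the variance bound. The linear lower bound
  for \<open>1 - exp (- 2 * t)\<close> is what confines \<open>t\<close> to a bounded range.\<close>

lemma energy_decay_short:
  fixes f :: "real^'n \<Rightarrow> real"
  assumes st: "0 < s" "s \<le> 2" "0 < t" "t \<le> 1" and p: "1 < p"
    and f: "continuous_on torus_cube f" and mean: "integral torus_cube f = 0"
  shows "energy p (frac_semigroup s t f) \<le> exp (- (min 1 (p - 1) / 8 * t)) * energy p f"
proof -
  define \<kappa> where "\<kappa> = min 1 (p - 1) / 2"
  have \<kappa>: "0 \<le> \<kappa>" using p by (auto simp: \<kappa>_def)
  define V where "V = energy p f - (integral torus_cube (\<lambda>x. spow (p / 2) (f x)))\<^sup>2"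
  have V: "energy p f / 2 \<le> V" unfolding V_def using energy_le_variance[OF p f mean] by simp
  have "exp (- 2 * t) \<le> 1 / (1 + 2 * t)"
    using exp_ge_add_one_self[of "2 * t"] st by (simp add: exp_minus divide_inverse le_imp_inverse_le)
  also have "\<dots> \<le> 1 - t / 2"
  proof -
    have "1 \<le> (1 - t / 2) * (1 + 2 * t)"
      using mult_mono[of t 1 t 1] mult_left_mono[of t 1 t] st by (simp add: algebra_simps)
    then show ?thesis using st by (simp add: pos_divide_le_eq)
  qed
  finally have e: "t / 2 \<le> 1 - exp (- 2 * t)" by simp
  have "energy p (frac_semigroup s t f) \<le> energy p f - \<kappa> * (1 - exp (- 2 * t)) * V"
    unfolding \<kappa>_def V_def by (rule energy_decrease[OF st(1-3) p f])
  also have "\<dots> \<le> energy p f - \<kappa> * (t / 2) * (energy p f / 2)"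
    using \<kappa> V e st energy_nonneg[of p f] by (intro diff_left_mono mult_mono mult_left_mono) auto
  also have "\<dots> = (1 + - (\<kappa> / 4 * t)) * energy p f" by (simp add: algebra_simps)
  also have "\<dots> \<le> exp (- (\<kappa> / 4 * t)) * energy p f"
    by (intro mult_right_mono exp_ge_add_one_self energy_nonneg)
  finally show ?thesis by (simp add: \<kappa>_def)
qed

section \<open>Semigroup law and decay for all times\<close>

lemma continuous_on_frac_semigroup:
  fixes f :: "real^'n \<Rightarrow> real"
  assumes "0 < s" "s \<le> 2" "0 < t" "continuous_on torus_cube f"
  shows "continuous_on X (frac_semigroup s t f)"
  unfolding frac_semigroup_def using assms by (intro continuous_on_fourier_mult frac_semigroup_props)

lemma integral_frac_semigroup:
  fixes f :: "real^'n \<Rightarrow> real"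
  assumes "0 < s" "s \<le> 2" "0 < t" "continuous_on torus_cube f"
  shows "integral torus_cube (frac_semigroup s t f) = integral torus_cube f"
  unfolding frac_semigroup_def using assms by (intro integral_fourier_mult frac_semigroup_props) auto

lemma frac_semigroup_add:
  fixes f :: "real^'n \<Rightarrow> real"
  assumes "0 < s" "s \<le> 2" "0 < t" "continuous_on torus_cube f"
  shows "frac_semigroup s t' (frac_semigroup s t f) = frac_semigroup s (t' + t) f"
  unfolding frac_semigroup_def
  by (rule ext, subst fourier_mult_mult, rule frac_semigroup_props(1)[OF assms(1-3)], rule assms(4))
     (simp add: algebra_simps flip: exp_add)

lemma energy_decay:
  fixes f :: "real^'n \<Rightarrow> real"
  assumes st: "0 < s" "s \<le> 2" "0 < t" and p: "1 < p"
    and f: "continuous_on torus_cube f" and mean: "integral torus_cube f = 0"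
  shows "energy p (frac_semigroup s t f) \<le> exp (- (min 1 (p - 1) / 8 * t)) * energy p f"
proof -
  define c where "c = min 1 (p - 1) / 8"
  obtain n :: nat where n: "t \<le> real n" using real_arch_simple by blast
  define h where "h = t / real n"
  have n0: "0 < n" using n st(3) by (cases n) auto
  have h: "0 < h" "h \<le> 1" "real n * h = t" using n n0 st by (auto simp: h_def)
  \<comment> \<open>Counting from \<open>Suc j\<close> keeps every time positive: at time 0 the
    symbol is constantly 1 and not summable. Each step starts from a continuous function of mean
    zero, so the short-time rate applies again and the exponents add.\<close>
  have "energy p (frac_semigroup s (real (Suc j) * h) f) \<le> exp (- (c * (real (Suc j) * h))) * energy p f" for j
  proof (induction j)
    case 0
    then show ?case using energy_decay_short[OF st(1,2) h(1,2) p f mean] by (simp add: c_def)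
  next
    case (Suc j)
    define T u where "T = real (Suc j) * h" and "u = frac_semigroup s T f"
    have T: "0 < T" using h by (simp add: T_def)
    have u: "continuous_on torus_cube u" "integral torus_cube u = 0"
      unfolding u_def using continuous_on_frac_semigroup integral_frac_semigroup st T f mean by metis+
    have "frac_semigroup s (real (Suc (Suc j)) * h) f = frac_semigroup s h u"
      unfolding u_def using frac_semigroup_add[OF st(1,2) T f, of h] by (simp add: T_def algebra_simps)
    then have "energy p (frac_semigroup s (real (Suc (Suc j)) * h) f) \<le> exp (- (c * h)) * energy p u"
      using energy_decay_short[OF st(1,2) h(1,2) p u] by (simp add: c_def)
    also have "\<dots> \<le> exp (- (c * h)) * (exp (- (c * T)) * energy p f)"
      using Suc by (intro mult_left_mono) (auto simp: u_def T_def)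
    also have "\<dots> = exp (- (c * (real (Suc (Suc j)) * h))) * energy p f"
      by (simp add: T_def algebra_simps flip: exp_add)
    finally show ?case .
  qed
  from this[of "n - 1"] show ?thesis using n0 h by (simp add: c_def)
qed

section \<open>Fourier inversion for smooth functions\<close>

lemma periodic_lattice:
  fixes f :: "real^'n \<Rightarrow> real"
  assumes per: "periodic_Zd f" and k: "k \<in> int_lattice"
  shows "f (x + k) = f x"
proof -
  have one: "f (x + axis i 1) = f x" for x i using per by (simp add: periodic_Zd_def)
  have nat: "f (x + axis i (real n)) = f x" for x i n
  proof (induction n)
    case 0
    have ax0: "axis i 0 = (0 :: real^'n)" by (simp add: vec_eq_iff axis_def)
    show ?case unfolding of_nat_0 ax0 by simp
  next
    case (Suc n)
    have e: "x + axis i (real (Suc n)) = (x + axis i (real n)) + axis i 1"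
      by (simp add: vec_eq_iff axis_def)
    show ?case unfolding e one by (rule Suc)
  qed
  have int: "f (x + axis i (real_of_int z)) = f x" for x i z
  proof (cases "0 \<le> z")
    case True then show ?thesis using nat[of x i "nat z"] by simp
  next
    case False
    have e: "x + axis i (real_of_int z) + axis i (real (nat (- z))) = x"
      using False by (simp add: vec_eq_iff axis_def)
    show ?thesis using nat[of "x + axis i (real_of_int z)" i "nat (- z)"] unfolding e by (rule sym)
  qed
  have part: "f (x + (\<Sum>i\<in>I. axis i (k $ i))) = f x" if "finite I" for I x
    using that
  proof (induction I arbitrary: x)
    case (insert i I)
    obtain z where z: "k $ i = of_int z" using k by (auto simp: int_lattice_def Ints_def)
    have e: "x + (\<Sum>i\<in>insert i I. axis i (k $ i)) = (x + axis i (k $ i)) + (\<Sum>i\<in>I. axis i (k $ i))"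
      using insert by (simp add: add.assoc)
    show ?case unfolding e insert.IH unfolding z by (rule int)
  qed simp
  have "(\<Sum>i\<in>UNIV. axis i (k $ i)) = k"
    by (simp add: vec_eq_iff axis_def sum.delta)
  then show ?thesis using part[of UNIV x] by simp
qed

lemma fourier_mult_sum:
  fixes u :: "'i \<Rightarrow> real^'n \<Rightarrow> real"
  assumes m: "msummable TYPE('n) m" "m 0 = 1" and u: "\<And>i. i \<in> I \<Longrightarrow> continuous_on torus_cube (u i)"
  shows "fourier_mult m (\<lambda>x. \<Sum>i\<in>I. u i x) y = (\<Sum>i\<in>I. fourier_mult m (u i) y)"
  using u
proof (induction I rule: infinite_finite_induct)
  case (insert i I)
  have "fourier_mult m (\<lambda>x. 1 * u i x + (\<Sum>i\<in>I. u i x)) y = 1 * fourier_mult m (u i) y + fourier_mult m (\<lambda>x. \<Sum>i\<in>I. u i x) y"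
    using insert by (intro fourier_mult_linear m continuous_on_sum) auto
  then show ?case using insert by simp
qed (simp_all add: fourier_mult_const m)

text \<open>Korovkin's argument: \<open>frac_semigroup s t\<close> is a positive operator fixing constants, so
  convergence at \<open>x\<close> only has to be checked on \<open>\<lambda>y. \<Sum>i. 1 - cos (2 * pi * (y $ i - x $ i))\<close>, which vanishes
  exactly on \<open>x + int_lattice\<close>.\<close>

lemma frac_semigroup_tendsto_0:
  fixes f :: "real^'n \<Rightarrow> real"
  assumes s: "0 < s" "s \<le> 2" and f: "continuous_on UNIV f" and per: "periodic_Zd f"
  shows "((\<lambda>t. frac_semigroup s t f x) \<longlongrightarrow> f x) (at_right 0)"
proof (rule tendstoI)
  fix e :: real assume "e > 0"
  define \<epsilon> where "\<epsilon> = e / 2"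
  have \<epsilon>: "\<epsilon> > 0" using \<open>e > 0\<close> by (simp add: \<epsilon>_def)
  define r where "r = (\<lambda>(i::'n) y. Re (char (axis i 1) (- x) * char (axis i 1) y))"
  define q where "q = (\<lambda>y. \<Sum>i\<in>UNIV. 1 - r i y)"
  have r: "r i y = cos (2 * pi * (y $ i - x $ i))" for i y
    unfolding r_def cis_mult by (simp add: inner_axis' algebra_simps)
  have rc: "continuous_on A (r i)" for A i
    unfolding r_def by (intro continuous_intros)
  have qc: "continuous_on A q" for A
    unfolding q_def by (intro continuous_intros rc)
  have q0: "0 \<le> q y" for y unfolding q_def r by (intro sum_nonneg) simp
  have fc: "continuous_on A f" for A using f continuous_on_subset by blast
  have qz: "f y = f x" if "q y = 0" for y
  proof -
    have "\<forall>i\<in>UNIV. 1 - r i y = 0"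
      using that unfolding q_def by (subst (asm) sum_nonneg_eq_0_iff) (auto simp: r)
    then have "\<exists>z::int. 2 * pi * (y $ i - x $ i) = of_int z * 2 * pi" for i
      unfolding r by (simp add: cos_one_2pi_int)
    have "(y - x) $ i \<in> \<int>" for i
    proof -
      obtain z :: int where "2 * pi * (y $ i - x $ i) = of_int z * 2 * pi"
        using \<open>\<And>i. \<exists>z::int. 2 * pi * (y $ i - x $ i) = of_int z * 2 * pi\<close> by blast
      then have "2 * pi * (y $ i - x $ i) = 2 * pi * of_int z" by (simp only: mult_ac)
      then have "(y - x) $ i = of_int z" by simp
      then show ?thesis by simp
    qed
    then have "y - x \<in> int_lattice" by (simp add: int_lattice_def)
    then show ?thesis using periodic_lattice[OF per, of "y - x" x] by simp
  qed
  obtain C where C: "0 \<le> C" "\<And>y. y \<in> torus_cube \<Longrightarrow> \<bar>f y - f x\<bar> \<le> \<epsilon> + C * q y"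
  proof -
    \<comment> \<open>On the compact set \<open>K\<close> the function \<open>q\<close> has a
      positive minimum, because a zero of \<open>q\<close> forces \<open>f y = f x\<close> by
      periodicity. The constant \<open>C\<close> is a bound for the oscillation divided by that
      minimum.\<close>
    define K where "K = {y \<in> torus_cube. \<epsilon> \<le> \<bar>f y - f x\<bar>}"
    have "closed {y \<in> torus_cube. \<epsilon> \<le> \<bar>f y - f x\<bar>}"
      by (intro continuous_on_closed_Collect_le continuous_intros fc compact_imp_closed compact_torus_cube)
    then have "compact (torus_cube \<inter> K)"
      unfolding K_def by (rule compact_Int_closed[OF compact_torus_cube])
    moreover have "torus_cube \<inter> K = K" by (auto simp: K_def)
    ultimately have K: "compact K" by simp
    have "continuous_on torus_cube (\<lambda>y. f y - f x)" by (intro continuous_intros fc)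
    then obtain B where B: "\<And>y. y \<in> torus_cube \<Longrightarrow> \<bar>f y - f x\<bar> \<le> B"
      using torus_bounded by blast
    show ?thesis
    proof (cases "K = {}")
      case True
      then show ?thesis by (intro that[of 0]) (force simp: K_def)+
    next
      case False
      obtain y0 where y0: "y0 \<in> K" "\<And>y. y \<in> K \<Longrightarrow> q y0 \<le> q y"
        using continuous_attains_inf[OF K False qc] by blast
      have "f y0 \<noteq> f x" using y0(1) \<epsilon> by (auto simp: K_def)
      then have pos: "0 < q y0" using qz[of y0] q0[of y0] by force
      have B0: "0 \<le> B" using B[of y0] y0(1) by (auto simp: K_def)
      show ?thesis
      proof (rule that[of "B / q y0"])
        show "0 \<le> B / q y0" using B0 pos by simp
        fix y :: "real^'n" assume y: "y \<in> torus_cube"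
        show "\<bar>f y - f x\<bar> \<le> \<epsilon> + B / q y0 * q y"
        proof (cases "y \<in> K")
          case True
          have "1 \<le> q y / q y0" using y0(2)[OF True] pos by simp
          then have "B * 1 \<le> B * (q y / q y0)" by (rule mult_left_mono[OF _ B0])
          then show ?thesis using B[OF y] \<epsilon> by simp
        next
          case False
          then have "\<bar>f y - f x\<bar> < \<epsilon>" using y by (auto simp: K_def)
          moreover have "0 \<le> B / q y0 * q y" using B0 pos q0[of y] by simp
          ultimately show ?thesis by linarith
        qed
      qed
    qed
  qed
  have bound: "\<bar>frac_semigroup s t f x - f x\<bar> \<le> \<epsilon> + C * (CARD('n) * (1 - exp (- t)))" if t: "0 < t" for t
  proof -
    define m where "m = (\<lambda>r::real. exp (- t * r powr s))"
    have m: "msummable TYPE('n) m" "pos_mult (\<lambda>k::real^'n. m (norm k))"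
      unfolding m_def by (rule frac_semigroup_props[OF s t])+
    have m0: "m 0 = 1" by (simp add: m_def)
    have Pr: "fourier_mult m (r i) x = exp (- t)" for i
    proof -
      have "fourier_mult m (r i) x = m (norm (axis i 1 :: real^'n)) * r i x"
        unfolding r_def by (rule fourier_mult_Re_char[OF int_lattice_axis])
      then show ?thesis by (simp add: m_def r norm_axis_1)
    qed
    have Pq: "fourier_mult m q x = CARD('n) * (1 - exp (- t))"
    proof -
      have "fourier_mult m (\<lambda>y. (-1) * r i y + 1) x = (-1) * exp (- t) + 1" for i
        unfolding fourier_mult_linear[OF m(1) rc continuous_on_const] Pr fourier_mult_const[of m, OF m0] ..
      then have "fourier_mult m (\<lambda>y. 1 - r i y) x = 1 - exp (- t)" for i by simp
      then show ?thesis unfolding q_def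
        by (subst fourier_mult_sum[OF m(1) m0]) (auto intro!: continuous_intros rc)
    qed
    have P: "0 \<le> \<epsilon> + C * (CARD('n) * (1 - exp (- t))) + \<sigma> * (fourier_mult m f x - f x)" if "\<bar>\<sigma>\<bar> = 1" for \<sigma>
    proof -
      \<comment> \<open>The sign \<open>\<sigma>\<close> treats the upper and the lower bound
        together; the grouping is the one that linearity of the multiplier expects.\<close>
      let ?h = "\<lambda>y. C * q y + (\<sigma> * f y + (\<epsilon> - \<sigma> * f x))"
      have "0 \<le> fourier_mult m ?h x"
      proof (rule fourier_mult_nonneg[OF m])
        show "continuous_on torus_cube ?h" by (intro continuous_intros qc fc)
        fix y :: "real^'n" assume "y \<in> torus_cube"
        from C(2)[OF this] have "f y - f x \<le> \<epsilon> + C * q y" "- (f y - f x) \<le> \<epsilon> + C * q y" by linarith+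
        moreover have "\<sigma> = 1 \<or> \<sigma> = -1" using that by linarith
        ultimately show "0 \<le> ?h y" by (elim disjE) simp_all
      qed
      also have "fourier_mult m ?h x = C * (CARD('n) * (1 - exp (- t))) + (\<sigma> * fourier_mult m f x + (\<epsilon> - \<sigma> * f x))"
        by (subst fourier_mult_linear[OF m(1)], intro qc, (intro continuous_intros fc)[1],
            subst fourier_mult_linear[OF m(1)], intro fc, (intro continuous_intros)[1])
           (simp add: Pq fourier_mult_const m0)
      finally show ?thesis by (simp add: algebra_simps)
    qed
    show ?thesis using P[of 1] P[of "-1"] unfolding frac_semigroup_def m_def[symmetric] by (simp add: abs_le_iff)
  qed
  have "((\<lambda>t. \<epsilon> + C * (CARD('n) * (1 - exp (- t)))) \<longlongrightarrow> \<epsilon> + C * (CARD('n) * (1 - exp (- 0)))) (at_right 0)"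
    by (intro tendsto_intros)
  then have "\<forall>\<^sub>F t in at_right 0. \<epsilon> + C * (CARD('n) * (1 - exp (- t))) < e"
    by (rule order_tendstoD) (use \<open>e > 0\<close> in \<open>simp add: \<epsilon>_def\<close>)
  then show "\<forall>\<^sub>F t in at_right 0. dist (frac_semigroup s t f x) (f x) < e"
    using eventually_at_right_less[of "0::real"]
  proof eventually_elim
    case (elim t)
    then show ?case using bound[of t] by (simp add: dist_real_def)
  qed
qed

section \<open>Decay of the Fourier coefficients of smooth functions\<close>

abbreviation pderiv_axis :: "(real^'n \<Rightarrow> real) \<Rightarrow> 'n \<Rightarrow> real^'n \<Rightarrow> real" where
  "pderiv_axis g i \<equiv> \<lambda>x. frechet_derivative g (at x) (axis i 1)"

lemma smooth_fun_differentiable: "smooth_fun g \<Longrightarrow> g differentiable (at x)"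
  by (erule smooth_fun.cases) blast

lemma smooth_fun_pderiv: "smooth_fun g \<Longrightarrow> smooth_fun (pderiv_axis g i)"
  by (erule smooth_fun.cases) blast

lemma smooth_fun_continuous: "smooth_fun g \<Longrightarrow> continuous_on A g"
  by (meson continuous_at_imp_continuous_on differentiable_imp_continuous_within smooth_fun_differentiable)

lemma periodic_pderiv:
  fixes g :: "real^'n \<Rightarrow> real"
  assumes g: "\<And>x. g differentiable (at x)" and per: "periodic_Zd g"
  shows "periodic_Zd (pderiv_axis g i)"
  unfolding periodic_Zd_def
proof (intro allI)
  fix x j
  let ?e = "axis j 1 :: real^'n"
  have "(g has_derivative frechet_derivative g (at (x + ?e))) (at (x + ?e))"
    using g frechet_derivative_works by blast
  then have "((\<lambda>y. g (y + ?e)) has_derivative frechet_derivative g (at (x + ?e))) (at x)"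
    by (rule has_derivative_compose[rotated, where f = "\<lambda>y. y + ?e", simplified]) (auto intro!: derivative_eq_intros)
  moreover have "(\<lambda>y. g (y + ?e)) = g" using per by (auto simp: periodic_Zd_def)
  ultimately have "frechet_derivative g (at (x + ?e)) = frechet_derivative g (at x)"
    by (simp add: frechet_derivative_at)
  then show "frechet_derivative g (at (x + ?e)) (axis i 1) = frechet_derivative g (at x) (axis i 1)" by simp
qed

text \<open>Let \<open>H h\<close> be the coefficient of \<open>g\<close> translated by
  \<open>h\<close> in direction \<open>i\<close>. Translation invariance makes it
  \<open>cis (2 * pi * k $ i * h)\<close> times the coefficient of \<open>g\<close>, and
  differentiation under the integral makes its derivative at 0 the coefficient of the partial
  derivative. The derivative is one-sided because the shift formula covers \<open>h\<close> in
  \<open>{0..1}\<close>.\<close>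

lemma fourier_coeff_pderiv:
  fixes g :: "real^'n \<Rightarrow> real"
  assumes g: "\<And>x. g differentiable (at x)" and g': "continuous_on UNIV (pderiv_axis g i)"
    and per: "periodic_Zd g" and k: "k \<in> int_lattice"
  shows "fourier_coeff (pderiv_axis g i) k = 2 * pi * k $ i * \<i> * fourier_coeff g k"
proof -
  define H where "H = (\<lambda>h::real. integral (cbox (vec (-1/2)) (vec (1/2))) (\<lambda>x. complex_of_real (g (x + axis i h)) * char (- k) x))"
  have gc: "continuous_on UNIV g"
    using g by (simp add: continuous_at_imp_continuous_on differentiable_imp_continuous_within)
  have ax: "axis i h = h *\<^sub>R (axis i 1 :: real^'n)" for h by (simp add: vec_eq_iff axis_def)
  have "(H has_vector_derivative integral (cbox (vec (-1/2)) (vec (1/2)))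
      (\<lambda>x. complex_of_real (pderiv_axis g i (x + axis i 0)) * char (- k) x)) (at 0 within {0..1})"
    unfolding H_def
  proof (rule leibniz_rule_vector_derivative)
    fix h :: real and x :: "real^'n"
    have "(g has_derivative frechet_derivative g (at (x + axis i h))) (at (x + axis i h))"
      using g frechet_derivative_works by blast
    then have G: "(g has_derivative frechet_derivative g (at (x + axis i h)))
        (at (x + axis i h) within (\<lambda>h. x + axis i h) ` {0..1})"
      by (rule has_derivative_at_withinI)
    have "((\<lambda>h. x + h *\<^sub>R axis i 1) has_vector_derivative axis i 1) (at h within {0..1})"
      unfolding has_vector_derivative_def by (auto intro!: derivative_eq_intros)
    then have "((\<lambda>h. x + axis i h) has_vector_derivative axis i 1) (at h within {0..1})"
      by (simp only: ax[symmetric])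
    from vector_derivative_diff_chain_within[OF this G]
    have "((\<lambda>h. g (x + axis i h)) has_real_derivative pderiv_axis g i (x + axis i h)) (at h within {0..1})"
      by (simp only: o_def has_real_derivative_iff_has_vector_derivative)
    then show "((\<lambda>h. complex_of_real (g (x + axis i h)) * char (- k) x) has_vector_derivative
        complex_of_real (pderiv_axis g i (x + axis i h)) * char (- k) x) (at h within {0..1})"
      by (intro has_vector_derivative_mult_left has_vector_derivative_of_real)
  next
    fix h :: real
    show "(\<lambda>x. complex_of_real (g (x + axis i h)) * char (- k) x) integrable_on cbox (vec (-1/2)) (vec (1/2))"
      by (intro integrable_continuous continuous_intros continuous_on_compose2[OF gc]) auto
  next
    have "continuous_on ({0..1} \<times> cbox (vec (-1/2)) (vec (1/2))) (\<lambda>p. complex_of_real (pderiv_axis g i (snd p + fst p *\<^sub>R axis i 1)) * char (- k) (snd p))"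
      by (intro continuous_intros continuous_on_compose2[OF g']) auto
    then show "continuous_on ({0..1} \<times> cbox (vec (-1/2)) (vec (1/2))) (\<lambda>(h, x). complex_of_real (pderiv_axis g i (x + axis i h)) * char (- k) x)"
      by (simp add: case_prod_beta ax[symmetric])
  qed auto
  then have d1: "(H has_vector_derivative fourier_coeff (pderiv_axis g i) k) (at 0 within {0..1})"
    by (simp add: fourier_coeff_char torus_cube_def ax[of 0])
  have H: "H h = cis (2 * pi * k $ i * h) * fourier_coeff g k" if h: "h \<in> {0..1}" for h
  proof -
    let ?F = "\<lambda>y. complex_of_real (g y) * char (- k) y"
    have eq: "complex_of_real (g (x + axis i h)) * char (- k) x = cis (2 * pi * k $ i * h) * ?F (x + axis i h)" for x
      by (simp add: cis_mult inner_add_right inner_axis algebra_simps)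
    have "H h = integral torus_cube (\<lambda>x. cis (2 * pi * k $ i * h) * ?F (x + axis i h))"
      unfolding H_def torus_cube_def eq ..
    also have "\<dots> = cis (2 * pi * k $ i * h) * integral torus_cube (\<lambda>x. ?F (x + axis i h))"
      by simp
    also have "integral torus_cube (\<lambda>x. ?F (x + axis i h)) = integral torus_cube ?F"
    proof (rule periodic_shift_integral)
      show "continuous_on UNIV ?F" by (intro continuous_intros gc)
      show "?F (x + axis i 1) = ?F x" for x
        using per cis_lattice_periodic[OF int_lattice_uminus[OF k]] by (simp add: periodic_Zd_def)
    qed (use h in auto)
    finally show ?thesis by (simp add: fourier_coeff_char)
  qed
  have "((\<lambda>z. exp (\<i> * (complex_of_real (2 * pi * k $ i) * z)) * fourier_coeff g k) has_field_derivative
      (2 * pi * k $ i * \<i>) * fourier_coeff g k) (at (complex_of_real 0))"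
    by (auto intro!: derivative_eq_intros)
  then have "((\<lambda>h. exp (\<i> * (complex_of_real (2 * pi * k $ i) * complex_of_real h)) * fourier_coeff g k) has_vector_derivative
      (2 * pi * k $ i * \<i>) * fourier_coeff g k) (at 0 within {0..1})"
    by (rule has_vector_derivative_real_field)
  then have "((\<lambda>h. cis (2 * pi * k $ i * h) * fourier_coeff g k) has_vector_derivative
      (2 * pi * k $ i * \<i>) * fourier_coeff g k) (at 0 within {0..1})"
    unfolding cis_conv_exp by (simp only: of_real_mult)
  then have "(H has_vector_derivative (2 * pi * k $ i * \<i>) * fourier_coeff g k) (at 0 within {0..1})"
    by (rule has_vector_derivative_transform[rotated 2]) (auto simp: H)
  from vector_derivative_unique_within[OF _ d1 this] show ?thesis
    by (simp add: at_within_Icc_at_right)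
qed

text \<open>Each derivative in direction \<open>i\<close> gains one factor \<open>k $ i\<close>, and
  derivatives of smooth periodic functions are again smooth and periodic.\<close>

lemma smooth_coord_decay:
  fixes f :: "real^'n \<Rightarrow> real"
  assumes "smooth_fun f" "periodic_Zd f"
  shows "\<exists>C. \<forall>k\<in>int_lattice. \<bar>k $ i\<bar> ^ N * norm (fourier_coeff f k) \<le> C"
  using assms
proof (induction N arbitrary: f)
  case 0
  obtain B where "\<And>x. x \<in> torus_cube \<Longrightarrow> \<bar>f x\<bar> \<le> B"
    using torus_bounded[OF smooth_fun_continuous[OF 0(1)]] by blast
  then show ?case using fourier_coeff_bound[OF smooth_fun_continuous[OF 0(1)], of B] by auto
next
  case (Suc N)
  obtain C where C: "\<And>k. k \<in> int_lattice \<Longrightarrow> \<bar>k $ i\<bar> ^ N * norm (fourier_coeff (pderiv_axis f i) k) \<le> C"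
    using Suc.IH[OF smooth_fun_pderiv[OF Suc.prems(1)] periodic_pderiv[OF smooth_fun_differentiable[OF Suc.prems(1)] Suc.prems(2)]]
    by blast
  show ?case
  proof (intro exI ballI)
    fix k :: "real^'n" assume k: "k \<in> int_lattice"
    have "fourier_coeff (pderiv_axis f i) k = 2 * pi * k $ i * \<i> * fourier_coeff f k"
      by (rule fourier_coeff_pderiv[OF smooth_fun_differentiable[OF Suc.prems(1)]
            smooth_fun_continuous[OF smooth_fun_pderiv[OF Suc.prems(1)]] Suc.prems(2) k])
    then have "norm (fourier_coeff (pderiv_axis f i) k) = 2 * pi * (\<bar>k $ i\<bar> * norm (fourier_coeff f k))"
      by (simp add: norm_mult abs_mult)
    with C[OF k] show "\<bar>k $ i\<bar> ^ Suc N * norm (fourier_coeff f k) \<le> C / (2 * pi)"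
      by (simp add: field_simps)
  qed
qed

lemma one_plus_norm_power_le:
  fixes k :: "real^'n"
  shows "(1 + norm k) ^ N \<le> (1 + real CARD('n)) ^ N * (1 + (\<Sum>i\<in>UNIV. \<bar>k $ i\<bar> ^ N))"
proof -
  define M where "M = Max (range (\<lambda>i. \<bar>k $ i\<bar>))"
  have M: "\<bar>k $ i\<bar> \<le> M" for i unfolding M_def by (intro Max_ge) auto
  have "M \<in> range (\<lambda>i. \<bar>k $ i\<bar>)" unfolding M_def by (intro Max_in) auto
  then obtain j where j: "M = \<bar>k $ j\<bar>" by auto
  have "norm k \<le> (\<Sum>i\<in>UNIV. \<bar>k $ i\<bar>)" by (rule norm_le_l1_cart)
  also have "\<dots> \<le> CARD('n) * M" using sum_bounded_above[of UNIV "\<lambda>i. \<bar>k $ i\<bar>" M] M by simp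
  also have "\<dots> \<le> CARD('n) * max 1 M" by (intro mult_left_mono) auto
  finally have "1 + norm k \<le> max 1 M + CARD('n) * max 1 M" by linarith
  then have "1 + norm k \<le> (1 + CARD('n)) * max 1 M" by (simp add: distrib_right)
  then have "(1 + norm k) ^ N \<le> ((1 + CARD('n)) * max 1 M) ^ N" by (intro power_mono) auto
  also have "\<dots> = (1 + real CARD('n)) ^ N * max 1 M ^ N" by (simp add: power_mult_distrib)
  also have "max 1 M ^ N \<le> 1 + M ^ N" using j by (auto simp: max_def)
  also have "M ^ N \<le> (\<Sum>i\<in>UNIV. \<bar>k $ i\<bar> ^ N)"
    unfolding j by (rule member_le_sum) auto
  finally show ?thesis by simp
qed

lemma smooth_fourier_decay:
  fixes f :: "real^'n \<Rightarrow> real"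
  assumes "smooth_fun f" "periodic_Zd f"
  shows "\<exists>C. \<forall>k\<in>int_lattice. (1 + norm k) ^ N * norm (fourier_coeff f k) \<le> C"
proof -
  obtain B where B: "\<And>k. k \<in> int_lattice \<Longrightarrow> norm (fourier_coeff f k) \<le> B"
    using smooth_coord_decay[OF assms, of undefined 0] by auto
  have "\<forall>i. \<exists>C. \<forall>k\<in>int_lattice. \<bar>k $ i\<bar> ^ N * norm (fourier_coeff f k) \<le> C"
    using smooth_coord_decay[OF assms] by blast
  then obtain C where "\<forall>i. \<forall>k\<in>int_lattice. \<bar>k $ i\<bar> ^ N * norm (fourier_coeff f k) \<le> C i"
    by (rule choice[THEN exE])
  then have C: "\<bar>k $ i\<bar> ^ N * norm (fourier_coeff f k) \<le> C i" if "k \<in> int_lattice" for i k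
    using that by blast
  show ?thesis
  proof (intro exI ballI)
    fix k :: "real^'n" assume k: "k \<in> int_lattice"
    have "(1 + norm k) ^ N * norm (fourier_coeff f k) \<le>
        ((1 + real CARD('n)) ^ N * (1 + (\<Sum>i\<in>UNIV. \<bar>k $ i\<bar> ^ N))) * norm (fourier_coeff f k)"
      by (intro mult_right_mono one_plus_norm_power_le) simp
    also have "\<dots> = (1 + real CARD('n)) ^ N * (norm (fourier_coeff f k) + (\<Sum>i\<in>UNIV. \<bar>k $ i\<bar> ^ N * norm (fourier_coeff f k)))"
      by (simp add: algebra_simps sum_distrib_left)
    also have "\<dots> \<le> (1 + real CARD('n)) ^ N * (B + (\<Sum>i\<in>UNIV. C i))"
      by (intro mult_left_mono add_mono sum_mono B C k) auto
    finally show "(1 + norm k) ^ N * norm (fourier_coeff f k) \<le> (1 + real CARD('n)) ^ N * (B + (\<Sum>i\<in>UNIV. C i))" .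
  qed
qed

text \<open>The weight dominates both 1 and \<open>norm k powr s\<close> for
  \<open>s \<le> 2\<close>, so one bound serves the series of \<open>f\<close> and that of
  \<open>frac_lap s f\<close>.\<close>

lemma smooth_fsummable:
  fixes f :: "real^'n \<Rightarrow> real"
  assumes f: "smooth_fun f" "periodic_Zd f"
  shows "(\<lambda>k. (1 + norm k)\<^sup>2 * norm (fourier_coeff f k)) summable_on int_lattice"
proof -
  define d where "d = 2 * CARD('n)"
  obtain C where C: "\<And>k. k \<in> int_lattice \<Longrightarrow> (1 + norm k) ^ (d + 2) * norm (fourier_coeff f k) \<le> C"
    using smooth_fourier_decay[OF f] by blast
  show ?thesis
  proof (rule summable_on_comparison_test)
    show "(\<lambda>k::real^'n. C * (1 / (1 + norm k) ^ d)) summable_on int_lattice"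
      unfolding d_def by (intro summable_on_cmult_right summable_on_lattice_power)
    fix k :: "real^'n" assume k: "k \<in> int_lattice"
    have pos: "0 < (1 + norm k) ^ d" by (simp add: add_pos_nonneg)
    have "(1 + norm k) ^ d * ((1 + norm k)\<^sup>2 * norm (fourier_coeff f k)) \<le> C"
      using C[OF k] unfolding power_add mult.assoc .
    then show "(1 + norm k)\<^sup>2 * norm (fourier_coeff f k) \<le> C * (1 / (1 + norm k) ^ d)"
      using pos by (simp add: pos_le_divide_eq mult.commute)
  qed simp
qed

text \<open>Abel summation: as \<open>t\<close> tends to 0, \<open>frac_semigroup 1 t f\<close> at
  \<open>x\<close> tends to the Fourier series by domination and to \<open>f x\<close> by the
  Korovkin argument.\<close>

lemma fourier_inversion:
  fixes f :: "real^'n \<Rightarrow> real"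
  assumes f: "continuous_on UNIV f" "periodic_Zd f" and sum: "fsummable (fourier_coeff f)"
  shows "f x = Re (fseries (fourier_coeff f) x)"
proof -
  have "((\<lambda>t. fseries (\<lambda>k. complex_of_real (exp (- t * norm k powr 1)) * fourier_coeff f k) x) \<longlongrightarrow>
      fseries (fourier_coeff f) x) (at_right 0)"
    unfolding fseries_def
  proof (rule infsum_tendsto_dominated[where M = "\<lambda>k. norm (fourier_coeff f k)"])
    show "((\<lambda>t. complex_of_real (exp (- t * norm k powr 1)) * fourier_coeff f k * char k x) \<longlongrightarrow>
        fourier_coeff f k * char k x) (at_right 0)" for k
    proof -
      have "((\<lambda>t. complex_of_real (exp (- t * norm k powr 1)) * fourier_coeff f k * char k x) \<longlongrightarrow>
          complex_of_real (exp (- 0 * norm k powr 1)) * fourier_coeff f k * char k x) (at_right 0)"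
        by (intro tendsto_intros)
      then show ?thesis by simp
    qed
    show "\<forall>\<^sub>F t in at_right 0. \<forall>k\<in>int_lattice. norm (complex_of_real (exp (- t * norm k powr 1)) * fourier_coeff f k * char k x)
        \<le> norm (fourier_coeff f k)"
      using eventually_at_right_less[of "0::real"]
      by eventually_elim (auto simp: norm_mult intro!: mult_left_le_one_le)
    show "(\<lambda>k. norm (fourier_coeff f k)) summable_on int_lattice" using sum by (simp add: fsummable_def)
  qed
  then have "((\<lambda>t. frac_semigroup 1 t f x) \<longlongrightarrow> Re (fseries (fourier_coeff f) x)) (at_right 0)"
    unfolding frac_semigroup_def fourier_mult_fseries by (rule tendsto_Re)
  moreover have "((\<lambda>t. frac_semigroup 1 t f x) \<longlongrightarrow> f x) (at_right 0)"
    by (rule frac_semigroup_tendsto_0) (use f in auto)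
  ultimately show ?thesis using tendsto_unique[of "at_right (0::real)"] by (metis trivial_limit_at_right_real)
qed

section \<open>The dissipation inequality\<close>

lemma integral_mult_Re_fseries:
  fixes \<psi> :: "real^'n \<Rightarrow> real"
  assumes a: "fsummable a" and \<psi>: "continuous_on torus_cube \<psi>"
  shows "integral torus_cube (\<lambda>x. Re (fseries a x) * \<psi> x) =
    Re (\<Sum>\<^sub>\<infinity>k\<in>int_lattice. a k * fourier_coeff \<psi> (- k))"
proof -
  have c: "continuous_on torus_cube (\<lambda>x. complex_of_real (\<psi> x))" by (intro continuous_intros \<psi>)
  have "integral torus_cube (\<lambda>x. Re (fseries a x) * \<psi> x) = integral torus_cube (\<lambda>x. Re (fseries a x * complex_of_real (\<psi> x)))"
    by simp
  also have "\<dots> = Re (integral torus_cube (\<lambda>x. fseries a x * complex_of_real (\<psi> x)))"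
    using integral_linear[OF torus_integrable bounded_linear_Re, OF continuous_on_mult[OF continuous_on_fseries[OF a] c]]
    by (simp add: o_def)
  also have "\<dots> = Re (\<Sum>\<^sub>\<infinity>k\<in>int_lattice. a k * fourier_coeff \<psi> (- k))"
    by (subst integral_fseries_mult[OF a c]) (simp add: fourier_coeff_char)
  finally show ?thesis .
qed

text \<open>The derivative at time 0 is taken in the weak sense because the intended
  \<open>\<psi>\<close>, a signed power of \<open>f\<close>, may be merely continuous. Since
  \<open>(1 - exp (- t * y)) / t \<le> y\<close>, the coefficients of the quotient are dominated by
  those of \<open>frac_lap s f\<close>.\<close>

lemma frac_lap_difference_quotient:
  fixes f \<psi> :: "real^'n \<Rightarrow> real"
  assumes s: "0 < s" "s \<le> 2" and f: "smooth_fun f" "periodic_Zd f" and \<psi>: "continuous_on torus_cube \<psi>"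
  shows "((\<lambda>t. integral torus_cube (\<lambda>x. (f x - frac_semigroup s t f x) * \<psi> x) / t) \<longlongrightarrow>
    integral torus_cube (\<lambda>x. frac_lap s f x * \<psi> x)) (at_right 0)"
proof -
  define F where "F = fourier_coeff f"
  have fc: "continuous_on A f" for A using f(1) by (rule smooth_fun_continuous)
  have pw: "norm k powr s \<le> (1 + norm k)\<^sup>2" for k :: "real^'n"
  proof -
    have "norm k powr s \<le> (1 + norm k) powr s" using s by (intro powr_mono2) auto
    also have "\<dots> \<le> (1 + norm k) powr 2" using s by (intro powr_mono) auto
    finally show ?thesis by simp
  qed
  have sF: "fsummable F"
    unfolding F_def by (rule fsummableI[OF smooth_fsummable[OF f]]) (simp add: mult_le_cancel_right1)
  have sL: "fsummable (\<lambda>k. complex_of_real (norm k powr s) * F k)"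
    unfolding F_def norm_mult
    by (rule fsummableI[OF smooth_fsummable[OF f]]) (auto simp: norm_mult intro!: mult_right_mono pw)
  obtain B where B: "\<And>x. x \<in> torus_cube \<Longrightarrow> \<bar>\<psi> x\<bar> \<le> B" using torus_bounded[OF \<psi>] by blast
  have \<psi>B: "norm (fourier_coeff \<psi> k) \<le> B" for k by (rule fourier_coeff_bound[OF \<psi> B])
  define D where "D = (\<lambda>t (k::real^'n). complex_of_real ((1 - exp (- t * norm k powr s)) / t))"
  have D: "norm (D t k) \<le> norm k powr s" if "0 < t" for t k
  proof -
    have "1 - exp (- t * norm k powr s) \<le> t * norm k powr s"
      using exp_ge_add_one_self[of "- t * norm k powr s"] by linarith
    moreover have "0 \<le> 1 - exp (- t * norm k powr s)" using that by simp
    ultimately show ?thesis using that unfolding D_def norm_of_real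
      by (simp add: pos_divide_le_eq mult.commute)
  qed
  have quot: "integral torus_cube (\<lambda>x. (f x - frac_semigroup s t f x) * \<psi> x) / t =
      Re (\<Sum>\<^sub>\<infinity>k\<in>int_lattice. D t k * F k * fourier_coeff \<psi> (- k))" if t: "0 < t" for t
  proof -
    have sE: "fsummable (\<lambda>k. complex_of_real (exp (- t * norm k powr s)) * F k)"
      unfolding F_def by (rule fsummable_mult_coeff[OF frac_semigroup_props(1)[OF s t] fc])
    have sD: "fsummable (\<lambda>k. D t k * F k)"
      by (rule fsummableI[OF sL[unfolded fsummable_def]]) (auto simp: norm_mult intro!: mult_right_mono D t)
    have e: "complex_of_real t * D t k = 1 - complex_of_real (exp (- t * norm k powr s))" for k
      using t by (simp add: D_def)
    have "complex_of_real t * (D t k * F k) = complex_of_real (-1) * (complex_of_real (exp (- t * norm k powr s)) * F k) + F k" for k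
      unfolding mult.assoc[symmetric] e by (simp add: algebra_simps)
    then have "complex_of_real t * fseries (\<lambda>k. D t k * F k) x =
        complex_of_real (-1) * fseries (\<lambda>k. complex_of_real (exp (- t * norm k powr s)) * F k) x + fseries F x" for x
      using fseries_linear[OF sE sF, of "complex_of_real (-1)" x]
        fseries_linear[OF sD, of "\<lambda>_. 0" "complex_of_real t" x] by (simp add: fsummable_def fseries_def)
    then have "f x - frac_semigroup s t f x = Re (complex_of_real t * fseries (\<lambda>k. D t k * F k) x)" for x
      using fourier_inversion[OF fc f(2) sF[unfolded F_def], of x]
      by (simp add: frac_semigroup_def fourier_mult_fseries F_def)
    then have "f x - frac_semigroup s t f x = t * Re (fseries (\<lambda>k. D t k * F k) x)" for x by simp
    then have "integral torus_cube (\<lambda>x. (f x - frac_semigroup s t f x) * \<psi> x) =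
        integral torus_cube (\<lambda>x. t * (Re (fseries (\<lambda>k. D t k * F k) x) * \<psi> x))"
      by (simp add: mult.assoc)
    also have "\<dots> = t * integral torus_cube (\<lambda>x. Re (fseries (\<lambda>k. D t k * F k) x) * \<psi> x)" by simp
    also have "\<dots> = t * Re (\<Sum>\<^sub>\<infinity>k\<in>int_lattice. D t k * F k * fourier_coeff \<psi> (- k))"
      by (subst integral_mult_Re_fseries[OF sD \<psi>]) simp
    finally show ?thesis using t by simp
  qed
  have "((\<lambda>t. \<Sum>\<^sub>\<infinity>k\<in>int_lattice. D t k * F k * fourier_coeff \<psi> (- k)) \<longlongrightarrow>
      (\<Sum>\<^sub>\<infinity>k\<in>int_lattice. complex_of_real (norm k powr s) * F k * fourier_coeff \<psi> (- k))) (at_right 0)"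
  proof (rule infsum_tendsto_dominated)
    show "((\<lambda>t. D t k * F k * fourier_coeff \<psi> (- k)) \<longlongrightarrow> complex_of_real (norm k powr s) * F k * fourier_coeff \<psi> (- k)) (at_right 0)" for k
    proof -
      have "((\<lambda>t. (1 - exp (- t * y)) / t) \<longlongrightarrow> y) (at_right 0)" for y :: real by real_asymp
      then show ?thesis unfolding D_def by (intro tendsto_intros)
    qed
    have "norm (D t k * F k * fourier_coeff \<psi> (- k)) \<le> norm (complex_of_real (norm k powr s) * F k) * B" if "0 < t" for t k
      unfolding norm_mult by (intro mult_mono \<psi>B) (use D[OF that] in auto)
    then show "\<forall>\<^sub>F t in at_right 0. \<forall>k\<in>int_lattice. norm (D t k * F k * fourier_coeff \<psi> (- k))
        \<le> norm (complex_of_real (norm k powr s) * F k) * B"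
      using eventually_at_right_less[of "0::real"] by (auto elim: eventually_mono)
    show "(\<lambda>k. norm (complex_of_real (norm k powr s) * F k) * B) summable_on int_lattice"
      using sL unfolding fsummable_def by (rule summable_on_cmult_left)
  qed
  from tendsto_Re[OF this] have "((\<lambda>t. Re (\<Sum>\<^sub>\<infinity>k\<in>int_lattice. D t k * F k * fourier_coeff \<psi> (- k))) \<longlongrightarrow>
     integral torus_cube (\<lambda>x. frac_lap s f x * \<psi> x)) (at_right 0)"
    unfolding frac_lap_def fourier_mult_fseries F_def[symmetric] integral_mult_Re_fseries[OF sL \<psi>] .
  then show ?thesis
    by (rule Lim_transform_eventually)
       (use quot in \<open>auto intro!: eventually_mono[OF eventually_at_right_less[of "0::real"]]\<close>)
qed

text \<open>By convexity the energy loss up to time \<open>t\<close> is at most \<open>p\<close>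
  times the pairing of \<open>f - frac_semigroup s t f\<close> with \<open>spow (p - 1) f\<close>.
  Dividing by \<open>t\<close> and letting \<open>t\<close> tend to 0 turns the decay rate into a
  lower bound, with no derivative of the energy itself.\<close>

lemma energy_dissipation:
  fixes f :: "real^'n \<Rightarrow> real"
  assumes s: "0 < s" "s \<le> 2" and p: "1 < p"
    and f: "smooth_fun f" "periodic_Zd f" "integral torus_cube f = 0"
  shows "min 1 (p - 1) / 8 / p * energy p f \<le>
    integral torus_cube (\<lambda>x. frac_lap s f x * spow (p - 1) (f x))"
proof -
  define c where "c = min 1 (p - 1) / 8"
  have fc: "continuous_on A f" for A using f(1) by (rule smooth_fun_continuous)
  define \<psi> where "\<psi> = (\<lambda>x. spow (p - 1) (f x))"
  have \<psi>: "continuous_on torus_cube \<psi>" unfolding \<psi>_def using p by (intro continuous_intros fc) auto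
  have quot: "(1 - exp (- (c * t))) / t * energy p f \<le>
      p * (integral torus_cube (\<lambda>x. (f x - frac_semigroup s t f x) * \<psi> x) / t)" if t: "0 < t" for t
  proof -
    let ?u = "frac_semigroup s t f"
    have uc: "continuous_on torus_cube ?u" by (rule continuous_on_frac_semigroup[OF s t fc])
    have "energy p f - energy p ?u \<le> p * integral torus_cube (\<lambda>x. (f x - ?u x) * \<psi> x)"
    proof (rule has_integral_le)
      show "((\<lambda>x. \<bar>f x\<bar> powr p - \<bar>?u x\<bar> powr p) has_integral energy p f - energy p ?u) torus_cube"
        unfolding energy_def using p by (intro has_integral_diff torus_has_integral continuous_intros fc uc) auto
      show "((\<lambda>x. p * ((f x - ?u x) * \<psi> x)) has_integral p * integral torus_cube (\<lambda>x. (f x - ?u x) * \<psi> x)) torus_cube"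
        by (intro has_integral_mult_right torus_has_integral continuous_intros fc uc \<psi>)
      fix x
      \<comment> \<open>The tangent inequality for the \<open>p\<close>-th power at
        \<open>f x\<close>, read off from the Bregman bound by dropping the square.\<close>
      have "0 \<le> min 1 (p - 1) / 2 * (spow (p/2) (?u x) - spow (p/2) (f x))\<^sup>2" using p by simp
      also have "\<dots> \<le> \<bar>?u x\<bar> powr p - \<bar>f x\<bar> powr p - p * \<psi> x * (?u x - f x)"
        unfolding \<psi>_def by (rule bregman_powr_lower[OF p])
      finally show "\<bar>f x\<bar> powr p - \<bar>?u x\<bar> powr p \<le> p * ((f x - ?u x) * \<psi> x)"
        by (simp add: algebra_simps)
    qed
    moreover have "energy p ?u \<le> exp (- (c * t)) * energy p f"
      unfolding c_def by (rule energy_decay[OF s t p fc f(3)])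
    ultimately have "(1 - exp (- (c * t))) * energy p f \<le> p * integral torus_cube (\<lambda>x. (f x - ?u x) * \<psi> x)"
      by (simp add: algebra_simps)
    then have "(1 - exp (- (c * t))) * energy p f / t \<le> p * integral torus_cube (\<lambda>x. (f x - ?u x) * \<psi> x) / t"
      using t by (intro divide_right_mono) auto
    then show ?thesis by simp
  qed
  have "((\<lambda>t. (1 - exp (- (c * t))) / t) \<longlongrightarrow> c) (at_right 0)" by real_asymp
  then have "((\<lambda>t. (1 - exp (- (c * t))) / t * energy p f) \<longlongrightarrow> c * energy p f) (at_right 0)"
    by (rule tendsto_mult_right)
  moreover have "((\<lambda>t. p * (integral torus_cube (\<lambda>x. (f x - frac_semigroup s t f x) * \<psi> x) / t)) \<longlongrightarrow>
      p * integral torus_cube (\<lambda>x. frac_lap s f x * \<psi> x)) (at_right 0)"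
    by (intro tendsto_mult_left frac_lap_difference_quotient[OF s f(1,2) \<psi>])
  moreover have "\<forall>\<^sub>F t in at_right 0. (1 - exp (- (c * t))) / t * energy p f \<le>
      p * (integral torus_cube (\<lambda>x. (f x - frac_semigroup s t f x) * \<psi> x) / t)"
    using quot by (auto intro!: eventually_mono[OF eventually_at_right_less[of "0::real"]])
  ultimately have "c * energy p f \<le> p * integral torus_cube (\<lambda>x. frac_lap s f x * \<psi> x)"
    by (intro tendsto_le[of "at_right (0::real)"]) auto
  then have "c / p * energy p f \<le> integral torus_cube (\<lambda>x. frac_lap s f x * \<psi> x)"
    using p by (simp add: pos_divide_le_eq mult.commute)
  then show ?thesis unfolding c_def \<psi>_def .
qed

theorem theorem4p1:
  fixes s p :: real
  assumes "0 < s" and "s \<le> 2" and "1 < p"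
  shows "\<exists>c>0. \<exists>c'>0. \<forall>f :: real^'n \<Rightarrow> real.
           smooth_fun f \<and> periodic_Zd f \<and> integral torus_cube f = 0 \<longrightarrow>
             (\<forall>t>0. Lp_norm_T p (frac_semigroup s t f) \<le> exp (- c * t) * Lp_norm_T p f) \<and>
             integral torus_cube (\<lambda>x. frac_lap s f x * (\<bar>f x\<bar> powr (p - 2) * f x))
               \<ge> c' * (Lp_norm_T p f) powr p"
proof -
  \<comment> \<open>One constant serves both claims. The division by \<open>p\<close> comes from the
    \<open>p\<close>-th root of the energy in the first and from the derivative of the
    \<open>p\<close>-th power in the second.\<close>
  define c where "c = min 1 (p - 1) / 8 / p"
  have c: "0 < c" using assms by (simp add: c_def)
  have Lp: "Lp_norm_T p f = energy p f powr (1 / p)" for f :: "real^'n \<Rightarrow> real"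
    by (simp add: Lp_norm_T_def energy_def)
  show ?thesis
  proof (intro exI[of _ c] conjI c allI impI)
    fix f :: "real^'n \<Rightarrow> real" and t :: real
    assume f: "smooth_fun f \<and> periodic_Zd f \<and> integral torus_cube f = 0" and t: "0 < t"
    have "energy p (frac_semigroup s t f) powr (1 / p) \<le> (exp (- (min 1 (p - 1) / 8 * t)) * energy p f) powr (1 / p)"
      using assms f t by (intro powr_mono2 energy_decay energy_nonneg smooth_fun_continuous) simp_all
    also have "\<dots> = exp (- (min 1 (p - 1) / 8 * t)) powr (1 / p) * energy p f powr (1 / p)"
      by (rule powr_mult)
    also have "exp (- (min 1 (p - 1) / 8 * t)) powr (1 / p) = exp (- c * t)"
      by (simp add: c_def powr_def)
    finally show "Lp_norm_T p (frac_semigroup s t f) \<le> exp (- c * t) * Lp_norm_T p f"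
      by (simp only: Lp)
  next
    fix f :: "real^'n \<Rightarrow> real"
    assume f: "smooth_fun f \<and> periodic_Zd f \<and> integral torus_cube f = 0"
    have "c * energy p f \<le> integral torus_cube (\<lambda>x. frac_lap s f x * spow (p - 1) (f x))"
      unfolding c_def using assms f by (intro energy_dissipation) auto
    moreover have "Lp_norm_T p f powr p = energy p f"
      using assms energy_nonneg[of p f] by (simp add: Lp powr_powr)
    ultimately show "integral torus_cube (\<lambda>x. frac_lap s f x * (\<bar>f x\<bar> powr (p - 2) * f x)) \<ge> c * (Lp_norm_T p f) powr p"
      by (simp only: spow_conv)
  qed
qed

end
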